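(* For $q=3^h$, $h\ge2$, let $\mathcal T_q$ consist of all real unit vectors $\phi\in\mathbb R^{\mathbb F_q^\times}$ which are constant on each absolute-trace class $\{m\in\mathbb F_q^\times:\operatorname{Tr}_{\mathbb F_q/\mathbb F_3}(m)=j\}$, $j\in\mathbb F_3$, with no condition on the sum of their three values. Then $$\max_{\phi\in\mathcal T_q}\sigma_{\min}(\mathcal M_\phi)=\frac{q(\sqrt2-1)}{q(2-\sqrt2)-1}.$$ Equality holds exactly for the trace-flat window $\phi_q$ (defined in the context), up to global sign and interchange of trace classes $1$ and $2$. In particular, every maximizer has its three trace-class values summing to zero.
   Context: $G_q=\mathbb F_q\rtimes\mathbb F_q^\times$ is the affine group with product $(k,l)(k',l')=(k+lk',ll')$, acting on $\mathbb C^{\mathbb F_q^\times}$ by the unitary representation $(\pi_q(k,l)f)(m)=\psi_0(km)f(lm)$, where $\psi_0$ is any fixed nontrivial additive character of $\mathbb F_q$. For a vector $\phi$, $\mathcal M_\phi:\mathbb C^{\mathbb F_q^\times\times\mathbb F_q^\times}\to\mathbb C^{G_q}$ is the linear map $\mathcal M_\phi(A)(g)=\langle A\pi_q(g)\phi,\pi_q(g)\phi\rangle$, and $\sigma_{\min}(\mathcal M_\phi)=\min_{A\ne0}\|\mathcal M_\phi(A)\|_{\ell^2(G_q)}/\|A\|_F$ (Frobenius norm; counting measure on $G_q$). Trace-flat window: with $r=\frac{-1+\sqrt{9-6\sqrt2}}2$ and $N_q=q(2-\sqrt2)-1$, $\phi_q(m)=N_q^{-1/2}\cdot 1$, $N_q^{-1/2}\cdot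 r$, $N_q^{-1/2}\cdot(-1-r)$ according as $\operatorname{Tr}_{\mathbb F_q/\mathbb F_3}(m)=0,1,2$, for $m\in\mathbb F_q^\times$. "Up to global sign and interchange of trace classes $1$ and $2$" means: the equality cases are the vectors $\pm\phi_q$ and $\pm\phi_q(-\,\cdot)$. *)

theory Defs
  imports "HOL-Analysis.Analysis"
begin

section \<open>The multiplicative group of a field as an index type\<close>

typedef (overloaded) 'a nonzero = "{x::'a::field. x \<noteq> 0}"
  morphisms elt Abs_nonzero
  by (rule exI[of _ 1]) simp

setup_lifting type_definition_nonzero

instantiation nonzero :: (field) comm_monoid_mult
begin
lift_definition one_nonzero :: "'a nonzero" is 1 by simp
lift_definition times_nonzero :: "'a nonzero \<Rightarrow> 'a nonzero \<Rightarrow> 'a nonzero" is "(*)" by simp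
instance by standard (transfer; simp add: mult.assoc mult.commute)+
end

instantiation nonzero :: (field) uminus
begin
lift_definition uminus_nonzero :: "'a nonzero \<Rightarrow> 'a nonzero" is uminus by simp
instance ..
end

instance nonzero :: ("{field,finite}") finite
proof
  have "inj (elt :: 'a nonzero \<Rightarrow> 'a)"
    by (simp add: elt_inject inj_on_def)
  then show "finite (UNIV :: 'a nonzero set)"
    by (rule finite_imageD[rotated]) (rule finite)
qed

section \<open>The affine group and its representation\<close>

text \<open>The affine group \<open>F \<rtimes> F\<^sup>\<times>\<close> has the underlying type \<^typ>\<open>'a \<times> 'a nonzero\<close>.\<close>

definition affine_mult ::
    "'a::field \<times> 'a nonzero \<Rightarrow> 'a \<times> 'a nonzero \<Rightarrow> 'a \<times> 'a nonzero" where
  "affine_mult g g' = (fst g + elt (snd g) * fst g', snd g * snd g')"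

definition additive_character :: "('a::field \<Rightarrow> complex) \<Rightarrow> bool" where
  "additive_character \<psi> \<longleftrightarrow> (\<forall>x y. \<psi> (x + y) = \<psi> x * \<psi> y) \<and> (\<forall>x. norm (\<psi> x) = 1)"

definition affine_rep ::
    "('a::{field,finite} \<Rightarrow> complex) \<Rightarrow> 'a \<times> 'a nonzero \<Rightarrow>
      complex ^ 'a nonzero \<Rightarrow> complex ^ 'a nonzero" where
  "affine_rep \<psi> g f = (\<chi> m. \<psi> (fst g * elt m) * f $ (snd g * m))"

lemma affine_rep_mult:
  assumes "additive_character \<psi>"
  shows "affine_rep \<psi> (affine_mult g g') f = affine_rep \<psi> g (affine_rep \<psi> g' f)"
  using assms
  by (simp add: affine_rep_def affine_mult_def additive_character_def vec_eq_iff
      times_nonzero.rep_eq algebra_simps)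

section \<open>The measurement map and its least singular value\<close>

text \<open>The Hermitian inner product, linear in the first argument; the library's
  \<open>\<bullet>\<close> on \<^typ>\<open>complex ^ 'n\<close> is only its real part.\<close>

definition cinner :: "complex ^ 'n::finite \<Rightarrow> complex ^ 'n \<Rightarrow> complex" where
  "cinner x y = (\<Sum>i\<in>UNIV. x $ i * cnj (y $ i))"

definition measurement_map ::
    "('a::{field,finite} \<Rightarrow> complex) \<Rightarrow> complex ^ 'a nonzero \<Rightarrow>
      complex ^ 'a nonzero ^ 'a nonzero \<Rightarrow> complex ^ ('a \<times> 'a nonzero)" where
  "measurement_map \<psi> \<phi> A =
     (\<chi> g. cinner (A *v affine_rep \<psi> g \<phi>) (affine_rep \<psi> g \<phi>))"

text \<open>The norm on \<^typ>\<open>complex ^ 'n ^ 'm\<close> is the Frobenius norm.  For linear maps the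
  infimum is a minimum, see \<open>sigma_min_attained\<close>.\<close>

definition sigma_min :: "(complex ^ 'n::finite ^ 'm::finite \<Rightarrow> complex ^ 'g::finite) \<Rightarrow> real" where
  "sigma_min M = (INF A \<in> UNIV - {0}. norm (M A) / norm A)"

lemma frobenius_norm:
  fixes A :: "complex ^ 'n::finite ^ 'm::finite"
  shows "norm A = sqrt (\<Sum>i\<in>UNIV. \<Sum>j\<in>UNIV. (cmod (A $ i $ j))\<^sup>2)"
  by (simp add: norm_vec_def L2_set_def sum_nonneg)

lemma linear_measurement_map: "linear (measurement_map \<psi> \<phi>)"
  by (rule linearI)
    (simp_all add: measurement_map_def cinner_def vec_eq_iff matrix_vector_mult_def
      sum.distrib distrib_right scaleR_conv_of_real[where ?'a = complex]
      sum_distrib_left sum_distrib_right mult.assoc)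

lemma sigma_min_attained:
  fixes M :: "complex ^ 'n::finite ^ 'm::finite \<Rightarrow> complex ^ 'g::finite"
  assumes M: "linear M"
  obtains A where "A \<noteq> 0" "sigma_min M = norm (M A) / norm A"
    "\<And>B. B \<noteq> 0 \<Longrightarrow> norm (M A) / norm A \<le> norm (M B) / norm B"
proof -
  let ?S = "sphere (0 :: complex ^ 'n ^ 'm) 1"
  have ne: "?S \<noteq> {}"
    by simp
  have "continuous_on ?S (\<lambda>A. norm (M A))"
    using M by (intro continuous_on_norm linear_continuous_on) (simp add: linear_conv_bounded_linear)
  then obtain A where A: "A \<in> ?S" and le: "\<forall>B\<in>?S. norm (M A) \<le> norm (M B)"
    using continuous_attains_inf[OF compact_sphere ne] by blast
  have min: "norm (M A) / norm A \<le> norm (M B) / norm B" if "B \<noteq> 0" for B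
  proof -
    have "norm (M A) \<le> norm (M ((1 / norm B) *\<^sub>R B))"
      using le that by simp
    also have "\<dots> = norm (M B) / norm B"
      using linear_scale[OF M] by simp
    finally show ?thesis
      using A by simp
  qed
  have nz: "A \<noteq> 0"
    using A by auto
  have "sigma_min M = norm (M A) / norm A"
    unfolding sigma_min_def
    by (rule cInf_eq_minimum) (use nz min in auto)
  with nz min show thesis
    using that by blast
qed

section \<open>Trace classes and the trace-flat window\<close>

text \<open>For a field with \<open>3 ^ h\<close> elements this is the trace down to the prime field, whose
  elements \<open>0, 1, 2\<close> are the corresponding numerals of the ambient field.\<close>

definition abs_trace :: "nat \<Rightarrow> 'a::field \<Rightarrow> 'a" where
  "abs_trace h x = (\<Sum>i<h. x ^ (3 ^ i))"

definition trace_class :: "nat \<Rightarrow> nat \<Rightarrow> 'a::field nonzero set" where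
  "trace_class h j = {m. abs_trace h (elt m) = of_nat j}"

definition trace_windows :: "nat \<Rightarrow> (real ^ 'a::{field,finite} nonzero) set" where
  "trace_windows h =
     {\<phi>. norm \<phi> = 1 \<and> (\<forall>j\<in>{0,1,2}. \<exists>c. \<forall>m\<in>trace_class h j. \<phi> $ m = c)}"

definition window_ratio :: real where
  "window_ratio = (- 1 + sqrt (9 - 6 * sqrt 2)) / 2"

definition trace_flat_window :: "nat \<Rightarrow> real ^ 'a::{field,finite} nonzero" where
  "trace_flat_window h =
     (\<chi> m. (if m \<in> trace_class h 0 then 1
            else if m \<in> trace_class h 1 then window_ratio
            else - 1 - window_ratio)
           / sqrt (real CARD('a) * (2 - sqrt 2) - 1))"

definition reflect :: "real ^ 'a::{field,finite} nonzero \<Rightarrow> real ^ 'a nonzero" where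
  "reflect \<phi> = (\<chi> m. \<phi> $ (- m))"

definition complexify :: "real ^ 'n::finite \<Rightarrow> complex ^ 'n" where
  "complexify \<phi> = (\<chi> m. complex_of_real (\<phi> $ m))"

definition window_sigma ::
    "('a::{field,finite} \<Rightarrow> complex) \<Rightarrow> real ^ 'a nonzero \<Rightarrow> real" where
  "window_sigma \<psi> \<phi> = sigma_min (measurement_map \<psi> (complexify \<phi>))"

end

(* Every window constant on trace classes is described by its three values a, b, c, and the
   difference n - m of an index pair is preserved by the representation, so M splits into one block
   per difference.  Testing the blocks of the differences 0 and 1 on vectors supported on at most
   six points of the form j n + k with j, k in F_3 and n outside F_3 bounds sigma_min by
     (q/sqrt 3) |b^2 - c^2|,   (q/3) |2a^2 - b^2 - c^2|,
     (q/3) |2bc - ab - ac|,    (q/sqrt 3) |a (b - c)|,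
   because (Tr l, Tr ln) is equidistributed on F_3^2.  Maximizing the least of these four numbers
   under the normalization forces b + c = -a and 2bc = (3 sqrt 2 - 4) a^2.  Conversely, under
   these two equations every block has the Gram matrix alpha I + gamma J with gamma \<ge> a^4 \<ge> 0, and
   passing from l in F to l in F^* only subtracts a^4 J, so sigma_min^2 is at least q alpha, which
   is the square of the bound. *)

theory Submission
  imports Defs "HOL-Computational_Algebra.Polynomial"
begin

text \<open>The four numbers are (2q/3) |Re z| and (2q/3) |Im z| for the nontrivial Fourier
  coefficients z of two functions on F_3: (a^2, b^2, c^2), which the block of difference 0 sees, and
  (bc, ac, ab), which the block of difference 1 sees because x + s and x - s with s \<noteq> 0 in
  F_3 are the two elements other than x. At a maximizer all four agree.

  The obstacle is that they agree twice. With b + c = -a and \<mu> = |b - c| / (sqrt 3 |a|) the ties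
  read 2 \<mu> = |1 - \<mu>^2|, so \<mu> is sqrt 2 - 1 or sqrt 2 + 1. For large q both solutions
  give values tending to 1 / sqrt 2; only the point 0, missing from the multiplicative group and
  hence from the weight of trace class 0 in the norm, separates them for finite q. The estimates
  have to be sharp enough to tell these two points apart, which dictates the constants of the
  extremal problem.\<close>

section \<open>The extremal problem for the class values\<close>

text \<open>Here \<open>p = (b + c) / a\<close> and \<open>\<mu> = \<bar>b - c\<bar> / (sqrt 3 * \<bar>a\<bar>)\<close>.  The lower bound on \<open>\<theta>\<close> is sharp:
  at \<open>\<theta> = 1 / (6 * sqrt 2)\<close>, the limit of large fields, the conjugate point \<open>\<mu> = sqrt 2 + 1\<close> ties.\<close>

lemma extremal_ratios:
  fixes k p \<mu> \<theta> :: real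
  defines "k \<equiv> sqrt 2 - 1" and "Y \<equiv> p\<^sup>2 + 3 * \<mu>\<^sup>2"
  defines "f \<equiv> k + \<theta> * (Y - (4 - 6 * k))"
  assumes \<theta>: "1 / (6 * sqrt 2) < \<theta>" "\<theta> \<le> 1 / 6" and \<mu>: "0 \<le> \<mu>"
    and A: "f \<le> \<bar>p\<bar> * \<mu>" and D: "f \<le> \<mu>"
    and B: "3 * f \<le> \<bar>2 - Y / 2\<bar>" and C: "3 * f \<le> \<bar>(p\<^sup>2 - 3 * \<mu>\<^sup>2) / 2 - p\<bar>"
  shows "p = - 1 \<and> \<mu> = k"
proof -
  define s P where "s = sqrt 2" and "P = \<bar>p\<bar>"
  have s2: "s * s = 2" and s: "7 / 5 < s" "s < 3 / 2"
    using real_less_rsqrt[of "7 / 5" 2] real_less_lsqrt[of "3 / 2" 2]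
    by (auto simp: s_def power2_eq_square)
  have ks: "k = s - 1" by (simp add: k_def s_def)
  have k2: "k * k = 1 - 2 * k" using s2 by (simp add: ks algebra_simps)
  have P: "0 \<le> P" "p * p = P * P" "p \<le> P" "- p \<le> P" by (auto simp: P_def)
  have Y: "Y = P * P + 3 * (\<mu> * \<mu>)" using P by (simp add: Y_def power2_eq_square)
  \<comment> \<open>4 - 6k = 1 + 3 k^2 is the value of \<open>Y\<close> at the claimed point p = -1,
    \<mu> = k, where \<open>f\<close> equals k. If \<open>Y\<close> were larger, B would push it
    beyond 10 + 6 sqrt 2, its value at the conjugate point, and D would push \<mu> beyond sqrt 2 +
    1; A and D together keep \<mu> below that.\<close>
  have Y0: "Y \<le> 4 - 6 * k"
  proof (rule ccontr)
    assume "\<not> ?thesis"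
    then have gt: "Y > 4 - 6 * k" by simp
    have "f > k + 1 / (6 * s) * (Y - (4 - 6 * k))"
      using mult_strict_right_mono[OF \<theta>(1), of "Y - (4 - 6 * k)"] gt by (simp add: f_def s_def)
    moreover have "k + 1 / (6 * s) * (Y - (4 - 6 * k)) = s * (2 + Y) / 12"
    proof -
      have r: "1 / (6 * s) = s / 12"
        using s s2 by (simp add: field_simps)
      show ?thesis
        using s2 unfolding r ks by (simp add: algebra_simps)
    qed
    ultimately have f: "s * (2 + Y) / 12 < f" by (simp only:)
    have "0 < \<theta>" using \<theta>(1) by (smt (verit) divide_pos_pos real_sqrt_gt_0_iff)
    have "Y > 4"
    proof (rule ccontr)
      assume "\<not> Y > 4"
      then have "3 * f \<le> 2 - Y / 2" using B by auto
      moreover have "f \<ge> k" using gt \<open>0 < \<theta>\<close> by (simp add: f_def)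
      ultimately show False using gt by linarith
    qed
    then have "3 * f \<le> Y / 2 - 2" using B by auto
    then have "(2 - s) * Y > 8 + 2 * s" using f by (simp add: algebra_simps)
    moreover have "(2 - s) * (10 + 6 * s) = 8 + 2 * s" using s2 by (simp add: algebra_simps)
    ultimately have "(2 - s) * (10 + 6 * s) < (2 - s) * Y" by simp
    then have Y1: "10 + 6 * s < Y" using s by simp
    have "s * (12 + 6 * s) < s * (2 + Y)" using Y1 s by simp
    moreover have "s * (12 + 6 * s) = 12 * s + 12" using s2 by (simp add: algebra_simps)
    ultimately have f1: "s + 1 < f" using f by linarith
    then have \<mu>1: "s + 1 < \<mu>" using D by simp
    \<comment> \<open>The constraint at P = 1, which follows for every P: for P \<ge> 1 it weakens
      D, and for P < 1 raising P to 1 in A gains (1 - P) \<mu>, no less than the s (1 - P^2) / 12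
      that it costs.\<close>
    have "s * (3 + 3 * (\<mu> * \<mu>)) / 12 < \<mu>"
    proof (cases "P \<ge> 1")
      case True
      then have "1 \<le> P * P" using mult_mono[of 1 P 1 P] by simp
      then have "s * (3 + 3 * (\<mu> * \<mu>)) \<le> s * (2 + Y)" using s Y by simp
      then show ?thesis using f D by simp
    next
      case False
      have "s * (1 + P) / 12 \<le> 2 * 2 / 12"
        using False s P by (intro divide_right_mono mult_mono) auto
      then have "0 \<le> (1 - P) * (\<mu> - s * (1 + P) / 12)"
        using False \<mu>1 s by (intro mult_nonneg_nonneg) auto
      then have "P * \<mu> - s * (P * P) / 12 \<le> \<mu> - s / 12" by (simp add: field_simps)
      moreover have "s * (2 + Y) / 12 < P * \<mu>" using f A P_def by simp
      ultimately show ?thesis unfolding Y by (simp add: field_simps)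
    qed
    then have "s * (1 + \<mu> * \<mu>) < 4 * \<mu>" by (simp add: algebra_simps)
    then have "s * (s * (1 + \<mu> * \<mu>)) < s * (4 * \<mu>)" using s by simp
    then have "s * s * (1 + \<mu> * \<mu>) < 4 * s * \<mu>" by (simp only: mult.assoc mult.left_commute)
    then have "2 * (1 + \<mu> * \<mu>) < 4 * s * \<mu>" by (simp only: s2)
    then have "(\<mu> - s) * (\<mu> - s) < 1" using s2 by (simp add: algebra_simps)
    moreover have "1 < (\<mu> - s) * (\<mu> - s)" using \<mu>1 mult_strict_mono[of 1 "\<mu> - s" 1 "\<mu> - s"] by simp
    ultimately show False by simp
  qed
  \<comment> \<open>Here the factor of \<theta> is nonpositive, so the upper end 1/6 of the range of
    \<theta> now gives the lower bound on \<open>f\<close>.\<close>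
  have "(1 / 6) * (Y - (4 - 6 * k)) \<le> \<theta> * (Y - (4 - 6 * k))"
    using \<theta>(2) Y0 by (intro mult_right_mono_neg) auto
  then have f: "2 * k - 2 / 3 + P * P / 6 + \<mu> * \<mu> / 2 \<le> f" unfolding f_def Y by simp
  \<comment> \<open>At P = 1 the constraint on \<mu> reads (1 - \<mu>)^2 \<le> (1 - k)^2, because (1
    - k)^2 = 2 - 4k.\<close>
  have key: "k \<le> \<mu>" if "2 * k - 2 / 3 + 1 / 6 + \<mu> * \<mu> / 2 \<le> \<mu>"
  proof (rule ccontr)
    assume "\<not> k \<le> \<mu>"
    then have "(1 - k) * (1 - k) < (1 - \<mu>) * (1 - \<mu>)"
      using s ks by (intro mult_strict_mono) auto
    then show False using that k2 by (simp add: algebra_simps)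
  qed
  show ?thesis
  proof (cases "P \<ge> 1")
    case True
    then have PP: "1 \<le> P * P" using mult_mono[of 1 P 1 P] by simp
    then have k: "k \<le> \<mu>" using key f D by simp
    have "k * k \<le> \<mu> * \<mu>" using k s ks by (intro mult_mono) auto
    then have *: "P * P = 1" "\<mu> * \<mu> = k * k" using Y0 Y PP k2 by auto
    then have "P = 1" "\<mu> = k" using P(1) \<mu> k s ks by (auto simp: square_eq_1_iff square_eq_iff)
    \<comment> \<open>Only C sees the sign of p: at p = 1, \<mu> = k it would require 3k \<le> 2 -
      3k, but k > 2/5.\<close>
    moreover have "p \<noteq> 1"
    proof
      assume p: "p = 1"
      have "f \<ge> k" using f * k2 by (simp add: field_simps)
      moreover have "p\<^sup>2 = 1" "3 * \<mu>\<^sup>2 = 3 - 6 * k"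
        using p * k2 by (simp_all add: power2_eq_square)
      then have "3 * f \<le> \<bar>(1 - (3 - 6 * k)) / 2 - 1\<bar>"
        using C p by (simp only:)
      then have "3 * f \<le> \<bar>3 * k - 2\<bar>"
        by (simp add: field_simps)
      ultimately show False
        using s ks by linarith
    qed
    ultimately show ?thesis by (auto simp: P_def)
  next
    case False
    \<comment> \<open>The two signs of the absolute value in C. The first alternative forces \<mu> <
      k and then contradicts A; the second contradicts P - P^2 \<le> 1/4.\<close>
    have "3 * f \<le> (P * P - 3 * (\<mu> * \<mu>)) / 2 + P \<or> 3 * f \<le> (3 * (\<mu> * \<mu>) - P * P) / 2 + P"
    proof -
      have half: "(u - v) / 2 = u / 2 - v / 2" for u v :: real
        by (rule diff_divide_distrib)
      show ?thesis
        using C P(2-4) unfolding power2_eq_square half by linarith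
    qed
    then show ?thesis
    proof
      assume "3 * f \<le> (P * P - 3 * (\<mu> * \<mu>)) / 2 + P"
      then have "\<mu> * \<mu> < k * k" using f False k2 by (simp add: field_simps)
      then have lt: "\<mu> < k" 
        using mult_mono[of k \<mu> k \<mu>] s ks \<mu> by (simp only: not_le[symmetric]) auto
      have f': "2 * k - 2 / 3 + P * P / 6 + \<mu> * \<mu> / 2 \<le> P * \<mu>" using f A by (simp add: P_def)
      show ?thesis
      \<comment> \<open>P \<mu> - P^2 / 6 peaks at P = 3 \<mu>. For \<mu> \<ge> 1/3 the peak is not
        before P = 1, so P = 1 is the worst case and \<open>key\<close> applies; otherwise the peak
        value 3 \<mu>^2 / 2 is already too small.\<close>
      proof (cases "\<mu> \<ge> 1 / 3")
        case True
        have "0 \<le> (1 - P) * (\<mu> - (1 + P) / 6)" using True False by (intro mult_nonneg_nonneg) auto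
        then have "P * \<mu> - P * P / 6 \<le> \<mu> - 1 / 6" by (simp add: field_simps)
        then show ?thesis using key f' lt by simp
      next
        case False
        have "0 \<le> (P - 3 * \<mu>) * (P - 3 * \<mu>)" by simp
        then have "P * \<mu> - P * P / 6 - \<mu> * \<mu> / 2 \<le> \<mu> * \<mu>" by (simp add: algebra_simps)
        moreover have "\<mu> * \<mu> \<le> 1 / 3 * (1 / 3)" using False \<mu> by (intro mult_mono) auto
        ultimately show ?thesis using f' s ks by simp
      qed
    next
      assume "3 * f \<le> (3 * (\<mu> * \<mu>) - P * P) / 2 + P"
      then have "6 * k - 2 \<le> P - P * P" using f by (simp add: field_simps)
      moreover have "0 \<le> (P - 1 / 2) * (P - 1 / 2)" by simp
      ultimately show ?thesis using s ks by (simp add: algebra_simps)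
    qed
  qed
qed

section \<open>Trace and additive characters in characteristic three\<close>

text \<open>Adding 1 to every element permutes the ring, yet adds q times 1 to the sum of all
  elements. With q = 3^h this yields characteristic three.\<close>

lemma of_nat_card_finite_ring: "of_nat CARD('a::{ring_1,finite}) = (0::'a)"
proof -
  have "(\<Sum>y\<in>UNIV. y + (1::'a)) = (\<Sum>y\<in>UNIV. y)"
    by (rule sum.reindex_bij_witness[of _ "\<lambda>y. y - 1" "\<lambda>y. y + 1"]) auto
  then show ?thesis
    by (simp add: sum.distrib)
qed

lemma power_card_finite_field: "(x::'a::{field,finite}) ^ CARD('a) = x"
proof (cases "x = 0")
  case False
  have "x ^ (CARD('a) - 1) * \<Prod>(UNIV - {0}) = (\<Prod>y\<in>UNIV - {0}. x * y)"
    by (simp add: prod.distrib)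
  also have "\<dots> = \<Prod>(UNIV - {0})"
    by (rule prod.reindex_bij_witness[of _ "\<lambda>y. y / x" "\<lambda>y. x * y"]) (use False in auto)
  finally have "x ^ (CARD('a) - 1) = 1"
    by simp
  then show ?thesis
    by (metis Suc_diff_1 mult_1_right power_Suc zero_less_card_finite)
qed simp

lemma additive_character_0 [simp]: "additive_character \<xi> \<Longrightarrow> \<xi> 0 = 1"
  by (metis add.right_neutral additive_character_def mult_cancel_left1 norm_zero zero_neq_one)

lemma additive_character_add: "additive_character \<xi> \<Longrightarrow> \<xi> (x + y) = \<xi> x * \<xi> y"
  by (simp add: additive_character_def)

lemma additive_character_minus:
  assumes "additive_character \<xi>"
  shows "\<xi> (- x) = cnj (\<xi> x)"
proof -
  have "\<xi> (- x) * \<xi> x = 1"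
    using additive_character_add[OF assms, of "- x" x] assms by simp
  moreover have "cnj (\<xi> x) * \<xi> x = 1"
    using assms by (simp add: additive_character_def mult.commute[of "cnj _"] flip: complex_norm_square)
  ultimately show ?thesis
    by (metis mult_right_cancel mult_zero_right zero_neq_one)
qed

lemma additive_character_diff:
  assumes "additive_character \<xi>"
  shows "\<xi> (x - y) = \<xi> x * cnj (\<xi> y)"
  using additive_character_add[OF assms, of x "- y"] additive_character_minus[OF assms] by simp

lemma sum_additive_character:
  fixes \<xi> :: "'a::{field,finite} \<Rightarrow> complex"
  assumes "additive_character \<xi>" and "\<exists>x. \<xi> x \<noteq> 1"
  shows "(\<Sum>l\<in>UNIV. \<xi> (l * y)) = (if y = 0 then of_nat CARD('a) else 0)"
proof (cases "y = 0")
  case False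
  obtain x where x: "\<xi> x \<noteq> 1"
    using assms by blast
  have "(\<Sum>l\<in>UNIV. \<xi> (l * y)) = (\<Sum>l\<in>UNIV. \<xi> ((l + x / y) * y))"
    by (rule sum.reindex_bij_witness[of _ "\<lambda>l. l + x / y" "\<lambda>l. l - x / y"]) auto
  also have "\<dots> = (\<Sum>l\<in>UNIV. \<xi> (l * y)) * \<xi> x"
    using False additive_character_add[OF assms(1)] by (simp add: distrib_right sum_distrib_right)
  finally show ?thesis
    using x False by auto
qed (use assms in simp)

locale ternary_field =
  fixes h :: nat and F :: "'a::{field,finite} itself"
  assumes card_F: "CARD('a) = 3 ^ h" and h_ge_2: "h \<ge> 2"
begin

abbreviation tr :: "'a \<Rightarrow> 'a" where "tr \<equiv> abs_trace h"

abbreviation \<F>\<^sub>3 :: "'a set" where "\<F>\<^sub>3 \<equiv> {0, 1, 2}"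

lemma three_eq_0: "(3::'a) = 0"
  using of_nat_card_finite_ring[where ?'a = 'a] by (simp add: card_F)

text \<open>As rewrite rules these reduce constants to 0, 1 or 2, so the simplifier can evaluate
  functions on F_3 by cases.\<close>

lemma ternary_numerals [simp]:
  "(3::'a) = 0" "(4::'a) = 1" "(- 1::'a) = 2" "(- 2::'a) = 1" "(2::'a) \<noteq> 0" "(2::'a) \<noteq> 1" "(1::'a) \<noteq> 2"
  "(0::'a) \<noteq> 2" "2 * (2 * x) = (x::'a)"
proof -
  show 3: "(3::'a) = 0" by (fact three_eq_0)
  have "(4::'a) = 3 + 1" "(- 1::'a) = 2 - 3" "(- 2::'a) = 1 - 3" "(1::'a) = 3 - 2" by simp_all
  then show 4: "(4::'a) = 1" "(- 1::'a) = 2" "(- 2::'a) = 1"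
    by (simp_all only: 3 add_0_left diff_0_right)
  show "(2::'a) \<noteq> 0"
    using \<open>1 = 3 - (2::'a)\<close> by (metis 3 diff_0_right zero_neq_one)
  show "(2::'a) \<noteq> 1" "(1::'a) \<noteq> 2"
    by (metis add_left_imp_eq one_add_one add.right_neutral zero_neq_one)+
  show "(0::'a) \<noteq> 2" using \<open>(2::'a) \<noteq> 0\<close> by metis
  have "2 * (2 * x) = 4 * x" by simp
  then show "2 * (2 * x) = x" by (simp only: 4 mult_1)
qed

lemma minus_eq_double: "- x = 2 * (x::'a)"
  by (metis ternary_numerals(3) mult_minus1)

lemma power_3_power_add: "(x + y) ^ (3 ^ i) = x ^ (3 ^ i) + (y::'a) ^ (3 ^ i)"
proof (induction i)
  case (Suc i)
  have cube: "(u + v) ^ 3 = u ^ 3 + v ^ 3 + 3 * (u\<^sup>2 * v + u * v\<^sup>2)" for u v :: 'a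
    by (simp add: power3_eq_cube power2_eq_square algebra_simps)
  show ?case
    by (simp add: power_Suc2 power_mult Suc del: power_Suc) (simp add: cube)
qed simp

lemma tr_add: "tr (x + y) = tr x + tr y"
  by (simp add: abs_trace_def power_3_power_add sum.distrib)

lemma tr_0: "tr 0 = 0"
  using tr_add[of 0 0] by simp

lemma tr_minus: "tr (- x) = - tr x"
  using tr_add[of x "- x"] by (simp add: tr_0 eq_neg_iff_add_eq_0 add.commute)

lemma tr_diff: "tr (x - y) = tr x - tr y"
  using tr_add[of x "- y"] by (simp add: tr_minus)

lemma tr_double: "tr (2 * x) = 2 * tr x"
  using tr_add[of x x] by simp

text \<open>Cubing shifts the summands of the trace by one place, and x^(3^h) = x closes the
  cycle.\<close>

lemma cube_tr: "tr x ^ 3 = tr x"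
proof -
  have "tr x ^ 3 = (\<Sum>i<h. x ^ 3 ^ Suc i)"
  proof (unfold abs_trace_def, induction h)
    case (Suc n)
    then show ?case
      using power_3_power_add[of _ _ 1] by (simp add: power_mult[symmetric] mult.commute)
  qed simp
  also have "\<dots> = tr x + x ^ 3 ^ h - x"
    unfolding abs_trace_def by (induction h) simp_all
  finally show ?thesis
    using power_card_finite_field[of x] by (simp add: card_F)
qed

lemma tr_in_prime_field: "tr x \<in> \<F>\<^sub>3"
proof -
  have "tr x * (tr x - 1) * (tr x - 2) = tr x ^ 3 - 3 * (tr x)\<^sup>2 + 2 * tr x"
    by (simp add: power3_eq_cube power2_eq_square algebra_simps)
  also have "\<dots> = 3 * tr x"
    by (simp only: cube_tr) simp
  finally show ?thesis
    by auto
qed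

text \<open>The trace is a nonzero polynomial (its coefficient at X is 1) of degree at most 3^(h -
  1) < q, so it has a nonroot; doubling turns a trace 2 into a trace 1 and conversely.\<close>

lemma tr_surj: 
  assumes "t \<in> \<F>\<^sub>3"
  shows "\<exists>x. tr x = t"
proof -
  define p :: "'a poly" where "p = (\<Sum>i<h. monom 1 (3 ^ i))"
  have p: "poly p x = tr x" for x
    by (simp add: p_def poly_sum poly_monom abs_trace_def)
  have "coeff p 1 = (\<Sum>i<h. if i = 0 then 1 else 0)"
    unfolding p_def coeff_sum by (intro sum.cong) auto
  then have "p \<noteq> 0"
    using h_ge_2 by auto
  then have "card {x. poly p x = 0} \<le> degree p"
    by (rule card_poly_roots_bound)
  also have "degree p \<le> 3 ^ (h - 1)"
    unfolding p_def
    by (intro degree_sum_le) (auto intro!: order.trans[OF degree_monom_le] power_increasing)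
  also have "\<dots> < CARD('a)"
    using h_ge_2 by (simp add: card_F)
  finally have "{x. poly p x = 0} \<noteq> UNIV"
    by auto
  then obtain x where x: "tr x \<noteq> 0"
    by (auto simp: p)
  then have "tr x = 1 \<or> tr x = 2"
    using tr_in_prime_field[of x] by auto
  then have "\<exists>y. tr y = 1"
    using tr_double[of x] by auto
  then show ?thesis
    using assms tr_0 tr_double by (metis empty_iff insert_iff mult_1_right)
qed

section \<open>Joint distribution of several traces\<close>

definition \<omega> :: complex where "\<omega> = Complex (- 1 / 2) (sqrt 3 / 2)"

lemma cube_root_of_unity: "\<omega> * \<omega> = - 1 - \<omega>" "\<omega> \<noteq> 1" "cmod \<omega> = 1"
  by (simp_all add: \<omega>_def complex_eq_iff cmod_def power_divide)

text \<open>The canonical additive character exp(2 pi i tr x / 3). It serves to count traces and is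
  independent of the character \<psi> of the representation.\<close>

definition \<xi> :: "'a \<Rightarrow> complex" where
  "\<xi> x = (if tr x = 0 then 1 else if tr x = 1 then \<omega> else \<omega> * \<omega>)"

lemma trace_character: "additive_character \<xi>" "\<exists>x. \<xi> x \<noteq> 1"
proof -
  have w3: "\<omega> * (\<omega> * \<omega>) = 1" by (simp add: cube_root_of_unity(1) algebra_simps)
  have "\<xi> (x + y) = \<xi> x * \<xi> y" for x y
    using tr_in_prime_field[of x] tr_in_prime_field[of y] by (auto simp: \<xi>_def tr_add w3 mult.assoc)
  moreover have "cmod (\<xi> x) = 1" for x
    by (simp add: \<xi>_def cube_root_of_unity(3) norm_mult)
  ultimately show "additive_character \<xi>"
    by (simp add: additive_character_def)
  show "\<exists>x. \<xi> x \<noteq> 1"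
    using tr_surj[of 1] cube_root_of_unity(2) by (auto simp: \<xi>_def)
qed

lemma indicator_tr: "of_bool (tr x = 0) = (\<Sum>j\<in>\<F>\<^sub>3. \<xi> (j * x)) / 3"
proof -
  have "1 + \<omega> + \<omega> * \<omega> = 0"
    by (simp add: cube_root_of_unity(1))
  then show ?thesis
    using tr_in_prime_field[of x] by (auto simp: \<xi>_def tr_0 tr_double add.assoc) (simp_all add: add_ac)
qed

text \<open>Expanding both indicators into characters leaves the sums of
  \<open>\<xi> (l * (j * x + k * y))\<close> over l. They vanish unless j x + k y = 0, so
  independence keeps only j = k = 0, with weight 1/9. The elements u and v shift the prescribed
  traces to 0.\<close>

lemma trace_count_2:
  assumes indep: "\<And>j k. j \<in> \<F>\<^sub>3 \<Longrightarrow> k \<in> \<F>\<^sub>3 \<Longrightarrow> j * x + k * y = 0 \<Longrightarrow> j = 0 \<and> k = 0"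
    and "s \<in> \<F>\<^sub>3" "e \<in> \<F>\<^sub>3"
  shows "(\<Sum>l\<in>UNIV. of_bool (tr (l * x) = s) * of_bool (tr (l * y) = e)) = real CARD('a) / 9"
proof -
  obtain u v where u: "tr u = s" and v: "tr v = e"
    using assms(2,3) tr_surj by metis
  let ?q = "of_nat CARD('a) :: complex"
  have "(\<Sum>l\<in>UNIV. of_bool (tr (l * x) = s) * of_bool (tr (l * y) = e)) =
      (\<Sum>l\<in>UNIV. of_bool (tr (l * x - u) = 0) * of_bool (tr (l * y - v) = 0) :: complex)"
    by (simp add: tr_diff u v)
  also have "\<dots> = (\<Sum>l\<in>UNIV. \<Sum>j\<in>\<F>\<^sub>3. \<Sum>k\<in>\<F>\<^sub>3. \<xi> (j * (l * x - u)) * \<xi> (k * (l * y - v)) / 9)"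
    unfolding indicator_tr sum_divide_distrib sum_product by simp
  also have "\<dots> = (\<Sum>j\<in>\<F>\<^sub>3. \<Sum>k\<in>\<F>\<^sub>3. \<Sum>l\<in>UNIV. \<xi> (j * (l * x - u)) * \<xi> (k * (l * y - v)) / 9)"
    by (subst sum.swap, rule sum.cong[OF refl], rule sum.swap)
  also have "\<dots> = (\<Sum>j\<in>\<F>\<^sub>3. \<Sum>k\<in>\<F>\<^sub>3. \<Sum>l\<in>UNIV. \<xi> (l * (j * x + k * y)) * \<xi> (- (j * u + k * v)) / 9)"
    by (intro sum.cong refl arg_cong[where f = "\<lambda>z. z / 9"])
      (simp add: algebra_simps flip: additive_character_add[OF trace_character(1)])
  also have "\<dots> = (\<Sum>j\<in>\<F>\<^sub>3. \<Sum>k\<in>\<F>\<^sub>3. (if j * x + k * y = 0 then ?q else 0) * \<xi> (- (j * u + k * v)) / 9)"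
    by (simp only: sum_divide_distrib[symmetric] sum_distrib_right[symmetric] sum_additive_character[OF trace_character])
  also have "\<dots> = (\<Sum>j\<in>\<F>\<^sub>3. \<Sum>k\<in>\<F>\<^sub>3. (if j = 0 \<and> k = 0 then ?q / 9 else 0))"
  proof (intro sum.cong refl)
    fix j k
    assume "j \<in> \<F>\<^sub>3" "k \<in> \<F>\<^sub>3"
    then have "j * x + k * y = 0 \<longleftrightarrow> j = 0 \<and> k = 0"
      using indep[OF \<open>j \<in> \<F>\<^sub>3\<close> \<open>k \<in> \<F>\<^sub>3\<close>] by (metis add_0 mult_zero_left)
    then show "(if j * x + k * y = 0 then ?q else 0) * \<xi> (- (j * u + k * v)) / 9 =
        (if j = 0 \<and> k = 0 then ?q / 9 else 0)"
      by (simp add: trace_character(1))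
  qed
  also have "\<dots> = ?q / 9"
    by simp
  finally have "of_real (\<Sum>l\<in>UNIV. of_bool (tr (l * x) = s) * of_bool (tr (l * y) = e)) =
      complex_of_real (real CARD('a) / 9)"
    by simp
  then show ?thesis
    by (simp only: of_real_eq_iff)
qed

lemma trace_count_3:
  assumes indep: "\<And>j k m. j \<in> \<F>\<^sub>3 \<Longrightarrow> k \<in> \<F>\<^sub>3 \<Longrightarrow> m \<in> \<F>\<^sub>3 \<Longrightarrow> j * x + k * y + m * z = 0 \<Longrightarrow>
      j = 0 \<and> k = 0 \<and> m = 0"
    and "s \<in> \<F>\<^sub>3" "e \<in> \<F>\<^sub>3" "f \<in> \<F>\<^sub>3"
  shows "(\<Sum>l\<in>UNIV. of_bool (tr (l * x) = s) * (of_bool (tr (l * y) = e) * of_bool (tr (l * z) = f))) =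
    real CARD('a) / 27"
proof -
  obtain u v w where u: "tr u = s" and v: "tr v = e" and w: "tr w = f"
    using assms(2,3,4) tr_surj by metis
  let ?q = "of_nat CARD('a) :: complex"
  have "(\<Sum>l\<in>UNIV. of_bool (tr (l * x) = s) * (of_bool (tr (l * y) = e) * of_bool (tr (l * z) = f))) =
      (\<Sum>l\<in>UNIV. of_bool (tr (l * x - u) = 0) *
        (of_bool (tr (l * y - v) = 0) * of_bool (tr (l * z - w) = 0)) :: complex)"
    by (simp add: tr_diff u v w)
  also have "\<dots> = (\<Sum>l\<in>UNIV. \<Sum>j\<in>\<F>\<^sub>3. \<Sum>k\<in>\<F>\<^sub>3. \<Sum>m\<in>\<F>\<^sub>3.
      \<xi> (j * (l * x - u)) * (\<xi> (k * (l * y - v)) * \<xi> (m * (l * z - w))) / 27)"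
  proof -
    have "a / 3 * (b / 3 * (c / 3)) = a * (b * c) / 27" for a b c :: complex
      by simp
    then show ?thesis
      by (simp only: indicator_tr) (simp only: sum_product, simp only: sum_distrib_left sum_divide_distrib)
  qed
  also have "\<dots> = (\<Sum>j\<in>\<F>\<^sub>3. \<Sum>k\<in>\<F>\<^sub>3. \<Sum>m\<in>\<F>\<^sub>3. \<Sum>l\<in>UNIV.
      \<xi> (j * (l * x - u)) * (\<xi> (k * (l * y - v)) * \<xi> (m * (l * z - w))) / 27)"
    by (subst sum.swap, rule sum.cong[OF refl], subst sum.swap, rule sum.cong[OF refl], rule sum.swap)
  also have "\<dots> = (\<Sum>j\<in>\<F>\<^sub>3. \<Sum>k\<in>\<F>\<^sub>3. \<Sum>m\<in>\<F>\<^sub>3. \<Sum>l\<in>UNIV.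
      \<xi> (l * (j * x + k * y + m * z)) * \<xi> (- (j * u + k * v + m * w)) / 27)"
    by (intro sum.cong refl arg_cong[where f = "\<lambda>z. z / 27"])
      (simp add: algebra_simps flip: additive_character_add[OF trace_character(1)])
  also have "\<dots> = (\<Sum>j\<in>\<F>\<^sub>3. \<Sum>k\<in>\<F>\<^sub>3. \<Sum>m\<in>\<F>\<^sub>3.
      (if j * x + k * y + m * z = 0 then ?q else 0) * \<xi> (- (j * u + k * v + m * w)) / 27)"
    by (simp only: sum_divide_distrib[symmetric] sum_distrib_right[symmetric] sum_additive_character[OF trace_character])
  also have "\<dots> = (\<Sum>j\<in>\<F>\<^sub>3. \<Sum>k\<in>\<F>\<^sub>3. \<Sum>m\<in>\<F>\<^sub>3. (if j = 0 \<and> k = 0 \<and> m = 0 then ?q / 27 else 0))"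
  proof (intro sum.cong refl)
    fix j k m
    assume "j \<in> \<F>\<^sub>3" "k \<in> \<F>\<^sub>3" "m \<in> \<F>\<^sub>3"
    then have "j * x + k * y + m * z = 0 \<longleftrightarrow> j = 0 \<and> k = 0 \<and> m = 0"
      using indep[OF \<open>j \<in> \<F>\<^sub>3\<close> \<open>k \<in> \<F>\<^sub>3\<close> \<open>m \<in> \<F>\<^sub>3\<close>] by (metis add_0 mult_zero_left)
    then show "(if j * x + k * y + m * z = 0 then ?q else 0) * \<xi> (- (j * u + k * v + m * w)) / 27 =
        (if j = 0 \<and> k = 0 \<and> m = 0 then ?q / 27 else 0)"
      by (simp add: trace_character(1))
  qed
  also have "\<dots> = ?q / 27"
    by simp
  finally have "of_real (\<Sum>l\<in>UNIV. of_bool (tr (l * x) = s) *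
      (of_bool (tr (l * y) = e) * of_bool (tr (l * z) = f))) = complex_of_real (real CARD('a) / 27)"
    by simp
  then show ?thesis
    by (simp only: of_real_eq_iff)
qed

lemma sum_trace_indicator: "(\<Sum>s\<in>\<F>\<^sub>3. of_bool (tr z = s) * G s) = (G (tr z) :: real)"
  using tr_in_prime_field[of z] by auto

lemma eq_double_if: "u + v = 0 \<Longrightarrow> v = 2 * (u::'a)"
  using minus_eq_double[of u] by (simp add: add_eq_0_iff)

text \<open>By \<open>trace_count_2\<close> each of the nine pairs of traces is taken equally often;
  the premises express linear independence of x and y over F_3.\<close>

lemma sum_traces_2:
  fixes g :: "'a \<Rightarrow> 'a \<Rightarrow> real"
  assumes xy: "x \<noteq> 0" "\<And>j. j \<in> \<F>\<^sub>3 \<Longrightarrow> y \<noteq> j * x"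
  shows "(\<Sum>l\<in>UNIV. g (tr (l * x)) (tr (l * y))) =
    real CARD('a) / 9 * (\<Sum>s\<in>\<F>\<^sub>3. \<Sum>e\<in>\<F>\<^sub>3. g s e)"
proof -
  have indep: "j = 0 \<and> k = 0" if "j \<in> \<F>\<^sub>3" "k \<in> \<F>\<^sub>3" "j * x + k * y = 0" for j k
  proof -
    have "k * y = (2 * j) * x"
      using eq_double_if[OF that(3)] by (simp add: mult.assoc)
    moreover have "2 * (k * y) = y" if "k = 2"
      using that by simp
    ultimately have "k = 0 \<or> (\<exists>i\<in>\<F>\<^sub>3. y = i * x)"
      using that(1,2) by auto
    then show ?thesis
      using that xy by auto
  qed
  have "(\<Sum>l\<in>UNIV. g (tr (l * x)) (tr (l * y))) =
      (\<Sum>l\<in>UNIV. \<Sum>s\<in>\<F>\<^sub>3. \<Sum>e\<in>\<F>\<^sub>3. of_bool (tr (l * x) = s) * of_bool (tr (l * y) = e) * g s e)"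
  proof (rule sum.cong[OF refl])
    show "g (tr (l * x)) (tr (l * y)) =
        (\<Sum>s\<in>\<F>\<^sub>3. \<Sum>e\<in>\<F>\<^sub>3. of_bool (tr (l * x) = s) * of_bool (tr (l * y) = e) * g s e)" for l
      by (simp only: mult.assoc sum_distrib_left[symmetric] sum_trace_indicator)
  qed
  also have "\<dots> = (\<Sum>s\<in>\<F>\<^sub>3. \<Sum>e\<in>\<F>\<^sub>3. \<Sum>l\<in>UNIV.
      of_bool (tr (l * x) = s) * of_bool (tr (l * y) = e) * g s e)"
    by (subst sum.swap, rule sum.cong[OF refl], rule sum.swap)
  also have "\<dots> = (\<Sum>s\<in>\<F>\<^sub>3. \<Sum>e\<in>\<F>\<^sub>3. real CARD('a) / 9 * g s e)"
    by (intro sum.cong refl)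
      (simp only: sum_distrib_right[symmetric], subst trace_count_2[OF indep]; simp)
  finally show ?thesis
    by (simp only: sum_distrib_left)
qed

text \<open>Serves the Gram entries of a block of nonzero difference d at positions x, y for which
  d, x, y are independent over F_3.\<close>

lemma sum_traces_3:
  fixes g :: "'a \<Rightarrow> 'a \<Rightarrow> 'a \<Rightarrow> real"
  assumes xy: "x \<noteq> 0" "\<And>j. j \<in> \<F>\<^sub>3 \<Longrightarrow> y \<noteq> j * x"
    and z: "\<And>j k. j \<in> \<F>\<^sub>3 \<Longrightarrow> k \<in> \<F>\<^sub>3 \<Longrightarrow> z \<noteq> j * x + k * y"
  shows "(\<Sum>l\<in>UNIV. g (tr (l * x)) (tr (l * y)) (tr (l * z))) =
    real CARD('a) / 27 * (\<Sum>s\<in>\<F>\<^sub>3. \<Sum>e\<in>\<F>\<^sub>3. \<Sum>f\<in>\<F>\<^sub>3. g s e f)"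
proof -
  have indep: "j = 0 \<and> k = 0 \<and> m = 0"
    if "j \<in> \<F>\<^sub>3" "k \<in> \<F>\<^sub>3" "m \<in> \<F>\<^sub>3" "j * x + k * y + m * z = 0" for j k m
  proof -
    have m: "m * z = (2 * j) * x + (2 * k) * y"
      using eq_double_if[OF that(4)] by (simp add: mult.assoc distrib_left)
    have dbl: "2 * i \<in> \<F>\<^sub>3" if "i \<in> \<F>\<^sub>3" for i
      using that by auto
    have "m \<noteq> 2"
      using arg_cong[OF m, of "\<lambda>z. 2 * z"] z[OF that(1,2)] by (auto simp: distrib_left mult.assoc)
    moreover have "m \<noteq> 1"
      using m z[OF dbl[OF that(1)] dbl[OF that(2)]] by auto
    ultimately have m0: "m = 0"
      using that(3) by simp
    then have "k * y = (2 * j) * x"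
      using eq_double_if[of "j * x" "k * y"] that(4) by (simp add: mult.assoc)
    moreover have "2 * (k * y) = y" if "k = 2"
      using that by simp
    ultimately have "k = 0 \<or> (\<exists>i\<in>\<F>\<^sub>3. y = i * x)"
      using that(1,2) by auto
    then show ?thesis
      using that xy m0 by auto
  qed
  have "(\<Sum>l\<in>UNIV. g (tr (l * x)) (tr (l * y)) (tr (l * z))) =
      (\<Sum>l\<in>UNIV. \<Sum>s\<in>\<F>\<^sub>3. \<Sum>e\<in>\<F>\<^sub>3. \<Sum>f\<in>\<F>\<^sub>3. of_bool (tr (l * x) = s) *
        (of_bool (tr (l * y) = e) * of_bool (tr (l * z) = f)) * g s e f)"
  proof (rule sum.cong[OF refl])
    show "g (tr (l * x)) (tr (l * y)) (tr (l * z)) = (\<Sum>s\<in>\<F>\<^sub>3. \<Sum>e\<in>\<F>\<^sub>3. \<Sum>f\<in>\<F>\<^sub>3.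
        of_bool (tr (l * x) = s) * (of_bool (tr (l * y) = e) * of_bool (tr (l * z) = f)) * g s e f)" for l
      by (simp only: mult.assoc sum_distrib_left[symmetric] sum_trace_indicator)
  qed
  also have "\<dots> = (\<Sum>s\<in>\<F>\<^sub>3. \<Sum>e\<in>\<F>\<^sub>3. \<Sum>f\<in>\<F>\<^sub>3. \<Sum>l\<in>UNIV. of_bool (tr (l * x) = s) *
        (of_bool (tr (l * y) = e) * of_bool (tr (l * z) = f)) * g s e f)"
    by (subst sum.swap, rule sum.cong[OF refl], subst sum.swap, rule sum.cong[OF refl], rule sum.swap)
  also have "\<dots> = (\<Sum>s\<in>\<F>\<^sub>3. \<Sum>e\<in>\<F>\<^sub>3. \<Sum>f\<in>\<F>\<^sub>3. real CARD('a) / 27 * g s e f)"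
    by (intro sum.cong refl)
      (simp only: sum_distrib_right[symmetric], subst trace_count_3[OF indep]; simp)
  finally show ?thesis
    by (simp only: sum_distrib_left)
qed

end

section \<open>Splitting the measurement map along diagonals\<close>

lemma norm_vec_power2: "(norm (v :: 'b::real_normed_vector ^ 'n::finite))\<^sup>2 = (\<Sum>i\<in>UNIV. (norm (v $ i))\<^sup>2)"
  by (simp add: norm_vec_def L2_set_def sum_nonneg)

lemma parseval_additive_character:
  fixes \<psi> :: "'a::{field,finite} \<Rightarrow> complex"
  assumes \<psi>: "additive_character \<psi>" "\<exists>x. \<psi> x \<noteq> 1"
  shows "(\<Sum>k\<in>UNIV. (cmod (\<Sum>d\<in>UNIV. \<psi> (k * d) * c d))\<^sup>2) = real CARD('a) * (\<Sum>d\<in>UNIV. (cmod (c d))\<^sup>2)"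
proof -
  have "complex_of_real (\<Sum>k\<in>UNIV. (cmod (\<Sum>d\<in>UNIV. \<psi> (k * d) * c d))\<^sup>2) =
      (\<Sum>k\<in>UNIV. \<Sum>d\<in>UNIV. \<Sum>e\<in>UNIV. \<psi> (k * d) * c d * cnj (\<psi> (k * e) * c e))"
    by (simp only: of_real_sum complex_norm_square cnj_sum sum_product)
  also have "\<dots> = (\<Sum>k\<in>UNIV. \<Sum>d\<in>UNIV. \<Sum>e\<in>UNIV. \<psi> (k * (d - e)) * (c d * cnj (c e)))"
    by (intro sum.cong refl)
      (simp add: right_diff_distrib additive_character_diff[OF \<psi>(1)])
  also have "\<dots> = (\<Sum>d\<in>UNIV. \<Sum>e\<in>UNIV. \<Sum>k\<in>UNIV. \<psi> (k * (d - e)) * (c d * cnj (c e)))"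
    by (subst sum.swap, rule sum.cong[OF refl], rule sum.swap)
  also have "\<dots> = (\<Sum>d\<in>UNIV. \<Sum>e\<in>UNIV. if d = e then of_nat CARD('a) * (c d * cnj (c e)) else 0)"
    by (intro sum.cong refl) (simp add: sum_additive_character[OF \<psi>] flip: sum_distrib_right)
  also have "\<dots> = complex_of_real (real CARD('a) * (\<Sum>d\<in>UNIV. (cmod (c d))\<^sup>2))"
    by (simp add: sum_distrib_left flip: complex_norm_square)
  finally show ?thesis
    by (simp only: of_real_eq_iff)
qed

lemma elt_nonzero [simp]: "elt m \<noteq> 0"
  using elt[of m] by simp

lemma elt_Abs_nonzero [simp]: "x \<noteq> 0 \<Longrightarrow> elt (Abs_nonzero x) = x"
  by (simp add: Abs_nonzero_inverse)

lemma sum_nonzero: "(\<Sum>l\<in>UNIV. g (elt l)) = (\<Sum>l\<in>UNIV. g l) - (g (0::'a::{field,finite}) :: 'b::ab_group_add)"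
proof -
  have "(\<Sum>l\<in>UNIV. g (elt l)) = sum g (UNIV - {0})"
    by (rule sum.reindex_bij_witness[of _ Abs_nonzero elt]) (auto simp: elt_inverse)
  then show ?thesis
    by (simp add: sum_diff1)
qed

definition window :: "('a::{field,finite} \<Rightarrow> real) \<Rightarrow> real ^ 'a nonzero" where
  "window V = (\<chi> m. V (elt m))"

text \<open>The entry \<open>A $ m $ n\<close> is addressed by \<open>m = x + d\<close>, \<open>n = x - d\<close>; in characteristic three
  the difference \<open>n - m = - 2 * d\<close> is \<open>d\<close> itself.\<close>

definition diag_entry :: "complex ^ 'a::{field,finite} nonzero ^ 'a nonzero \<Rightarrow> 'a \<Rightarrow> 'a \<Rightarrow> complex" where
  "diag_entry A d x =
     (if x + d = 0 \<or> x - d = 0 then 0 else A $ Abs_nonzero (x + d) $ Abs_nonzero (x - d))"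

context ternary_field begin

lemma sum_matrix_entries:
  fixes H :: "'a nonzero \<Rightarrow> 'a nonzero \<Rightarrow> 'b::comm_monoid_add"
  shows "(\<Sum>m\<in>UNIV. \<Sum>n\<in>UNIV. H m n) = (\<Sum>d\<in>UNIV. \<Sum>x\<in>UNIV.
    if x + d = 0 \<or> x - d = 0 then 0 else H (Abs_nonzero (x + d)) (Abs_nonzero (x - d)))"
proof -
  let ?S = "{(d, x :: 'a). x + d \<noteq> 0 \<and> x - d \<noteq> 0}"
  have eqs: "2 * (u + v) + 2 * (u - v) = u" "2 * (u + v) - 2 * (u - v) = v" for u v :: 'a
  proof -
    have "2 * (u + v) + 2 * (u - v) = 4 * u" "2 * (u + v) - 2 * (u - v) = 4 * v" by (simp_all add: algebra_simps)
    then show "2 * (u + v) + 2 * (u - v) = u" "2 * (u + v) - 2 * (u - v) = v" by simp_all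
  qed
  have eqs': "2 * ((x + d) - (x - d)) = d" "2 * ((x + d) + (x - d)) = x" for x d :: 'a
  proof -
    have "2 * ((x + d) - (x - d)) = 4 * d" "2 * ((x + d) + (x - d)) = 4 * x" by (simp_all add: algebra_simps)
    then show "2 * ((x + d) - (x - d)) = d" "2 * ((x + d) + (x - d)) = x" by simp_all
  qed
  have "(\<Sum>m\<in>UNIV. \<Sum>n\<in>UNIV. H m n) = (\<Sum>(m, n)\<in>UNIV. H m n)"
    by (simp add: sum.cartesian_product flip: UNIV_Times_UNIV)
  also have "\<dots> = (\<Sum>(d, x)\<in>?S. H (Abs_nonzero (x + d)) (Abs_nonzero (x - d)))"
    by (rule sum.reindex_bij_witness[of _ "\<lambda>(d, x). (Abs_nonzero (x + d), Abs_nonzero (x - d))"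
          "\<lambda>(m, n). (2 * (elt m - elt n), 2 * (elt m + elt n))"])
      (simp_all only: eqs eqs' elt_inverse elt_nonzero mem_Collect_eq split_beta elt_Abs_nonzero fst_conv snd_conv
          prod.collapse UNIV_I not_False_eq_True)
  also have "\<dots> = (\<Sum>(d, x)\<in>UNIV.
      if x + d = 0 \<or> x - d = 0 then 0 else H (Abs_nonzero (x + d)) (Abs_nonzero (x - d)))"
    by (intro sum.mono_neutral_cong_left) auto
  finally show ?thesis
    by (simp add: sum.cartesian_product flip: UNIV_Times_UNIV)
qed

lemma norm_eq_diag_entries: "(norm A)\<^sup>2 = (\<Sum>d\<in>UNIV. \<Sum>x\<in>UNIV. (cmod (diag_entry A d (x::'a)))\<^sup>2)"
  by (simp add: norm_vec_power2 sum_matrix_entries diag_entry_def if_distrib[of "\<lambda>z. (cmod z)\<^sup>2"] cong: if_cong)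

text \<open>At (k, l) the additive coordinate k enters only through the phase \<psi>(k d) of each
  difference d, so Parseval in k decouples the differences.\<close>

lemma norm_measurement_map:
  fixes V :: "'a \<Rightarrow> real"
  assumes \<psi>: "additive_character \<psi>" "\<exists>x. \<psi> x \<noteq> 1"
  shows "(norm (measurement_map \<psi> (complexify (window V)) A))\<^sup>2 =
    real CARD('a) * (\<Sum>l\<in>UNIV. \<Sum>d\<in>UNIV. (cmod (\<Sum>x\<in>UNIV.
      diag_entry A d x * of_real (V (elt l * (x + d)) * V (elt l * (x - d)))))\<^sup>2)"
    (is "_ = _ * (\<Sum>l\<in>UNIV. \<Sum>d\<in>UNIV. (cmod (?X l d))\<^sup>2)")
proof -
  have M: "measurement_map \<psi> (complexify (window V)) A $ (k, l) = (\<Sum>d\<in>UNIV. \<psi> (k * d) * ?X l d)" for k l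
  proof -
    have "measurement_map \<psi> (complexify (window V)) A $ (k, l) =
        (\<Sum>m\<in>UNIV. \<Sum>n\<in>UNIV. \<psi> (k * (elt n - elt m)) *
          (A $ m $ n * of_real (V (elt l * elt m) * V (elt l * elt n))))"
      by (simp add: measurement_map_def cinner_def affine_rep_def matrix_vector_mult_def complexify_def
          window_def times_nonzero.rep_eq sum_distrib_right)
        (simp add: right_diff_distrib additive_character_diff[OF \<psi>(1)] mult_ac)
    also have "\<dots> = (\<Sum>d\<in>UNIV. \<Sum>x\<in>UNIV. \<psi> (k * d) *
        (diag_entry A d x * of_real (V (elt l * (x + d)) * V (elt l * (x - d)))))"
    proof (subst sum_matrix_entries, intro sum.cong refl)
      fix d x :: 'a
      have "x - d - (x + d) = - 2 * d" by simp
      also have "\<dots> = d" by (simp only: ternary_numerals mult_1)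
      finally show "(if x + d = 0 \<or> x - d = 0 then 0
         else \<psi> (k * (elt (Abs_nonzero (x - d)) - elt (Abs_nonzero (x + d)))) *
           (A $ Abs_nonzero (x + d) $ Abs_nonzero (x - d) *
            of_real (V (elt l * elt (Abs_nonzero (x + d))) * V (elt l * elt (Abs_nonzero (x - d)))))) =
         \<psi> (k * d) * (diag_entry A d x * of_real (V (elt l * (x + d)) * V (elt l * (x - d))))"
        by (simp add: diag_entry_def)
    qed
    finally show ?thesis
      by (simp only: sum_distrib_left)
  qed
  have "(norm (measurement_map \<psi> (complexify (window V)) A))\<^sup>2 =
      (\<Sum>k\<in>UNIV. \<Sum>l\<in>UNIV. (cmod (\<Sum>d\<in>UNIV. \<psi> (k * d) * ?X l d))\<^sup>2)"
    unfolding norm_vec_power2 M[symmetric] by (simp add: sum.cartesian_product flip: UNIV_Times_UNIV)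
  also have "\<dots> = (\<Sum>l\<in>UNIV. \<Sum>k\<in>UNIV. (cmod (\<Sum>d\<in>UNIV. \<psi> (k * d) * ?X l d))\<^sup>2)"
    by (rule sum.swap)
  finally show ?thesis
    unfolding parseval_additive_character[OF \<psi>] sum_distrib_left[symmetric] .
qed

lemma window_sigma_nonneg: "0 \<le> window_sigma \<psi> (\<phi> :: real ^ 'a nonzero)"
  unfolding window_sigma_def sigma_min_def
  by (rule cINF_greatest) (auto intro: exI[of _ "\<chi> i j. 1"] simp: vec_eq_iff)

text \<open>The test matrix carries \<open>f\<close> on the single diagonal of difference d. The
  positions x = d and x = -d would need the index 0, which the multiplicative group lacks; hence the
  two vanishing conditions.\<close>

lemma window_sigma_le:
  fixes f :: "'a \<Rightarrow> real" and d :: 'a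
  assumes \<psi>: "additive_character \<psi>" "\<exists>x. \<psi> x \<noteq> 1" and f: "f d = 0" "f (- d) = 0"
  shows "(window_sigma \<psi> (window V))\<^sup>2 * (\<Sum>x\<in>UNIV. (f x)\<^sup>2) \<le>
    real CARD('a) * (\<Sum>l\<in>UNIV. (\<Sum>x\<in>UNIV. f x * (V (elt l * (x + d)) * V (elt l * (x - d))))\<^sup>2)"
proof -
  define A :: "complex ^ 'a nonzero ^ 'a nonzero" where
    "A = (\<chi> m n. if elt n - elt m = d then of_real (f (elt m - d)) else 0)"
  have A: "diag_entry A e x = (if e = d then of_real (f x) else 0)" for e x
  proof -
    have "x - e - (x + e) = - 2 * e" by simp
    also have "\<dots> = e" by (simp only: ternary_numerals mult_1)
    finally show ?thesis
      using f eq_neg_iff_add_eq_0[of x d] by (auto simp: diag_entry_def A_def)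
  qed
  have nA: "(norm A)\<^sup>2 = (\<Sum>x\<in>UNIV. (f x)\<^sup>2)"
    unfolding norm_eq_diag_entries A by (subst sum.swap) (simp add: if_distrib[of "\<lambda>z. (cmod z)\<^sup>2"] cong: if_cong)
  have "(norm (measurement_map \<psi> (complexify (window V)) A))\<^sup>2 = real CARD('a) * (\<Sum>l\<in>UNIV. \<Sum>e\<in>UNIV.
      if e = d then (\<Sum>x\<in>UNIV. f x * (V (elt l * (x + d)) * V (elt l * (x - d))))\<^sup>2 else 0)"
    unfolding norm_measurement_map[OF \<psi>] A
    by (intro arg_cong2[where f = "(*)"] sum.cong refl) 
      (auto simp flip: of_real_mult of_real_sum)
  then have nM: "(norm (measurement_map \<psi> (complexify (window V)) A))\<^sup>2 =
      real CARD('a) * (\<Sum>l\<in>UNIV. (\<Sum>x\<in>UNIV. f x * (V (elt l * (x + d)) * V (elt l * (x - d))))\<^sup>2)"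
    by simp
  show ?thesis
  proof (cases "A = 0")
    case False
    have "window_sigma \<psi> (window V) \<le> norm (measurement_map \<psi> (complexify (window V)) A) / norm A"
      unfolding window_sigma_def sigma_min_def
      by (rule cINF_lower) (use False in \<open>auto intro!: bdd_belowI2[of _ 0]\<close>)
    then have "window_sigma \<psi> (window V) * norm A \<le> norm (measurement_map \<psi> (complexify (window V)) A)"
      using False by (simp add: field_simps)
    then have "(window_sigma \<psi> (window V) * norm A)\<^sup>2 \<le> (norm (measurement_map \<psi> (complexify (window V)) A))\<^sup>2"
      by (rule power_mono) (simp add: window_sigma_nonneg)
    then show ?thesis
      by (simp add: power_mult_distrib nA nM)
  next
    case True
    then show ?thesis
      using nA by (simp flip: nA) (simp add: sum_nonneg)
  qed
qed

text \<open>The blocks are orthogonal, so a bound valid on each of them adds up to one for all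
  matrices.\<close>

lemma window_sigma_ge:
  assumes \<psi>: "additive_character \<psi>" "\<exists>x. \<psi> x \<noteq> 1" and "0 \<le> s"
    and bound: "\<And>d (f :: 'a \<Rightarrow> complex). f d = 0 \<Longrightarrow> f (- d) = 0 \<Longrightarrow> s\<^sup>2 * (\<Sum>x\<in>UNIV. (cmod (f x))\<^sup>2) \<le> real CARD('a) *
      (\<Sum>l\<in>UNIV. (cmod (\<Sum>x\<in>UNIV. f x * of_real (V (elt l * (x + d)) * V (elt l * (x - d)))))\<^sup>2)"
  shows "s \<le> window_sigma \<psi> (window V)"
  unfolding window_sigma_def sigma_min_def
proof (rule cINF_greatest)
  show "UNIV - {0 :: complex ^ 'a nonzero ^ 'a nonzero} \<noteq> {}"
    by (auto intro: exI[of _ "\<chi> i j. 1"] simp: vec_eq_iff)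
next
  fix A :: "complex ^ 'a nonzero ^ 'a nonzero"
  assume A: "A \<in> UNIV - {0}"
  have "(s * norm A)\<^sup>2 = (\<Sum>d\<in>UNIV. s\<^sup>2 * (\<Sum>x\<in>UNIV. (cmod (diag_entry A d x))\<^sup>2))"
    by (simp add: power_mult_distrib norm_eq_diag_entries sum_distrib_left)
  also have "\<dots> \<le> (\<Sum>d\<in>UNIV. real CARD('a) * (\<Sum>l\<in>UNIV. (cmod (\<Sum>x\<in>UNIV.
      diag_entry A d x * of_real (V (elt l * (x + d)) * V (elt l * (x - d)))))\<^sup>2))"
    by (intro sum_mono bound) (simp_all add: diag_entry_def)
  also have "\<dots> = (norm (measurement_map \<psi> (complexify (window V)) A))\<^sup>2"
    unfolding norm_measurement_map[OF \<psi>] sum_distrib_left by (rule sum.swap)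
  finally have "s * norm A \<le> norm (measurement_map \<psi> (complexify (window V)) A)"
    by (rule power2_le_imp_le) simp
  then show "s \<le> norm (measurement_map \<psi> (complexify (window V)) A) / norm A"
    using A by (simp add: field_simps)
qed

end

section \<open>Test matrices\<close>

definition class_value :: "real \<Rightarrow> real \<Rightarrow> real \<Rightarrow> 'a::field \<Rightarrow> real" where
  "class_value a b c t = (if t = 0 then a else if t = 1 then b else c)"

context ternary_field begin

lemma ternary_numerals' [simp]:
  "(5::'a) = 2" "(6::'a) = 0" "(7::'a) = 1" "(8::'a) = 2" "(9::'a) = 0" "(10::'a) = 1"
proof -
  have "(5::'a) = 4 + 1" "(6::'a) = 3 + 3" "(7::'a) = 3 + 4" "(8::'a) = 4 + 4" "(9::'a) = 3 + (3 + 3)"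
    "(10::'a) = 3 + (3 + 4)"
    by (simp_all del: ternary_numerals)
  from this[unfolded ternary_numerals]
  show "(5::'a) = 2" "(6::'a) = 0" "(7::'a) = 1" "(8::'a) = 2" "(9::'a) = 0" "(10::'a) = 1"
    by (simp_all only: one_add_one add_0_left)
qed

lemma class_value_simps [simp]:
  "class_value a b c (0::'a) = a" "class_value a b c (1::'a) = b" "class_value a b c (2::'a) = c"
  by (simp_all add: class_value_def)

lemma tr_mult_prime_field: "j \<in> \<F>\<^sub>3 \<Longrightarrow> tr (j * x) = j * tr x"
  by (auto simp: tr_0 tr_double)

lemma ex_notin_prime_field: "\<exists>n. n \<notin> \<F>\<^sub>3"
proof -
  have "card \<F>\<^sub>3 \<le> 3"
    by simp
  also have "3 < CARD('a)"
    using power_strict_increasing[of 1 h "3::nat"] h_ge_2 by (simp add: card_F)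
  finally have "\<F>\<^sub>3 \<noteq> UNIV"
    by (metis less_irrefl)
  then show ?thesis
    by blast
qed

text \<open>1 and n are linearly independent over F_3: a nonzero j - j' is 1 or 2, hence its own
  inverse, and would put n into F_3.\<close>

lemma combination_inject:
  assumes "n \<notin> \<F>\<^sub>3" "j \<in> \<F>\<^sub>3" "k \<in> \<F>\<^sub>3" "j' \<in> \<F>\<^sub>3" "k' \<in> \<F>\<^sub>3"
  shows "j * n + k = j' * n + k' \<longleftrightarrow> j = j' \<and> k = k'"
proof
  assume eq: "j * n + k = j' * n + k'"
  have T: "j - j' \<in> \<F>\<^sub>3" "k' - k \<in> \<F>\<^sub>3" "2 * (k' - k) \<in> \<F>\<^sub>3"
    using assms(2-) by auto
  have "(j - j') * n = k' - k"
    using eq by (simp add: algebra_simps)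
  moreover from this have "2 * ((j - j') * n) = 2 * (k' - k)"
    by (rule arg_cong)
  then have "n = 2 * (k' - k)" if "j - j' = 2"
    using that by (simp only: ternary_numerals)
  ultimately have "j - j' \<noteq> 1" "j - j' \<noteq> 2"
    using T(2,3) assms(1) by (metis mult_1, metis)
  then have "j - j' = 0"
    using T(1) by blast
  then show "j = j' \<and> k = k'"
    using eq by simp
qed simp

lemma sum_list_delta:
  "(\<Sum>x\<in>UNIV. (\<Sum>(c, p)\<leftarrow>L. c * of_bool (x = p)) * g x) = (\<Sum>(c, p)\<leftarrow>L. c * g (p :: 'b::finite) :: real)"
proof (induction L)
  case (Cons a L)
  obtain c p where a: "a = (c, p)" by fastforce
  have "(\<Sum>x\<in>UNIV. c * of_bool (x = p) * g x) = c * g p"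
    by (simp add: of_bool_def if_distrib[of "\<lambda>z. c * z * _"] cong: if_cong) 
  with Cons show ?case
    by (simp add: a distrib_right sum.distrib)
qed simp

text \<open>A triple \<open>(r, j, k)\<close> of \<open>L\<close> stands for the weight \<open>r\<close> at the point \<open>j * n + k\<close>, where \<open>n\<close> is
  any element outside the prime field.\<close>

lemma window_sigma_test:
  fixes L :: "(real \<times> 'a \<times> 'a) list" and V :: "'a \<Rightarrow> real"
  assumes \<psi>: "additive_character \<psi>" "\<exists>x. \<psi> x \<noteq> 1" and d: "d \<in> \<F>\<^sub>3"
    and L: "\<And>r j k. (r, j, k) \<in> set L \<Longrightarrow> j \<in> \<F>\<^sub>3 \<and> k \<in> \<F>\<^sub>3 \<and> (j \<noteq> 0 \<or> k \<noteq> d \<and> k \<noteq> - d)"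
  defines "G \<equiv> \<lambda>s e. \<Sum>(r, j, k)\<leftarrow>L. r * (V (j * e + k * s + d * s) * V (j * e + k * s - d * s))"
  assumes K: "(\<Sum>(r, j, k)\<leftarrow>L. r * (\<Sum>(r', j', k')\<leftarrow>L. r' * of_bool (j = j' \<and> k = k'))) = K"
    and E: "(\<Sum>s\<in>\<F>\<^sub>3. \<Sum>e\<in>\<F>\<^sub>3. (G s e)\<^sup>2) = E" and G0: "G 0 0 = 0"
  shows "(window_sigma \<psi> (window (\<lambda>x. V (tr x))))\<^sup>2 * K \<le> (real CARD('a))\<^sup>2 / 9 * E"
proof -
  obtain n where n: "n \<notin> \<F>\<^sub>3"
    using ex_notin_prime_field by blast
  define P where "P = (\<lambda>(r :: real, j, k). (r, j * n + k))"
  define f where "f x = (\<Sum>(r, p)\<leftarrow>map P L. r * of_bool (x = p))" for x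
  have fp: "f (i * n + m) = (\<Sum>(r', j', k')\<leftarrow>L. r' * of_bool (i = j' \<and> m = k'))"
    if "i \<in> \<F>\<^sub>3" "m \<in> \<F>\<^sub>3" for i m
    unfolding f_def map_map
  proof (intro arg_cong[where f = sum_list] map_cong refl)
    fix z assume z: "z \<in> set L"
    obtain r j k where [simp]: "z = (r, j, k)" by (cases z)
    show "((\<lambda>(r, p). r * of_bool (i * n + m = p)) \<circ> P) z =
        (case z of (r', j', k') \<Rightarrow> r' * of_bool (i = j' \<and> m = k'))"
      using combination_inject[OF n that] L[of r j k] z by (simp add: P_def)
  qed
  have zero: "(\<Sum>(r', j', k')\<leftarrow>L. r' * of_bool (0 = j' \<and> m = k')) = 0" if "m = d \<or> m = - d" for m
  proof -
    have "(\<Sum>(r', j', k')\<leftarrow>L. r' * of_bool (0 = j' \<and> m = k')) = (\<Sum>_\<leftarrow>L. 0)"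
      using L that by (intro arg_cong[where f = sum_list] map_cong refl) fastforce
    then show ?thesis
      by (simp only: sum_list_0)
  qed
  have fd: "f d = 0" "f (- d) = 0"
    using fp[of 0 d] fp[of 0 "- d"] zero[of d] zero[of "- d"] d by auto
  have G: "(\<Sum>x\<in>UNIV. f x * (V (tr (l * (x + d))) * V (tr (l * (x - d))))) = G (tr l) (tr (l * n))" for l
    unfolding f_def sum_list_delta unfolding map_map G_def
  proof (intro arg_cong[where f = sum_list] map_cong refl)
    fix z assume z: "z \<in> set L"
    obtain r j k where [simp]: "z = (r, j, k)" by (cases z)
    have jk: "j \<in> \<F>\<^sub>3" "k \<in> \<F>\<^sub>3"
      using L[of r j k] z by auto
    have "l * (j * n + k + d) = j * (l * n) + k * l + d * l" "l * (j * n + k - d) = j * (l * n) + k * l - d * l"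
      by (simp_all add: algebra_simps)
    then show "((\<lambda>(r, p). r * (V (tr (l * (p + d))) * V (tr (l * (p - d))))) \<circ> P) z =
        (case z of (r, j, k) \<Rightarrow> r * (V (j * tr (l * n) + k * tr l + d * tr l) * V (j * tr (l * n) + k * tr l - d * tr l)))"
      using jk d by (simp only: P_def o_apply \<open>z = _\<close> prod.case tr_add tr_diff tr_mult_prime_field)
  qed
  have "(\<Sum>x\<in>UNIV. (f x)\<^sup>2) = (\<Sum>x\<in>UNIV. (\<Sum>(r, p)\<leftarrow>map P L. r * of_bool (x = p)) * f x)"
    by (simp add: f_def power2_eq_square)
  also have "\<dots> = (\<Sum>(r, j, k)\<leftarrow>L. r * (\<Sum>(r', j', k')\<leftarrow>L. r' * of_bool (j = j' \<and> k = k')))"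
    unfolding sum_list_delta unfolding map_map
  proof (intro arg_cong[where f = sum_list] map_cong refl)
    fix z assume z: "z \<in> set L"
    obtain r j k where [simp]: "z = (r, j, k)" by (cases z)
    have jk: "j \<in> \<F>\<^sub>3" "k \<in> \<F>\<^sub>3"
      using L[of r j k] z by auto
    show "((\<lambda>(r, p). r * f p) \<circ> P) z =
        (case z of (r, j, k) \<Rightarrow> r * (\<Sum>(r', j', k')\<leftarrow>L. r' * of_bool (j = j' \<and> k = k')))"
      using fp[OF jk] by (simp add: P_def)
  qed
  finally have sq: "(\<Sum>x\<in>UNIV. (f x)\<^sup>2) = (\<Sum>(r, j, k)\<leftarrow>L. r * (\<Sum>(r', j', k')\<leftarrow>L. r' * of_bool (j = j' \<and> k = k')))" .
  \<comment> \<open>The omitted l = 0 has both traces 0 and takes away the square of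
    \<open>G 0 0\<close>, which is 0 for the test vectors; this is why their weights sum to
    zero.\<close>
  have en: "(\<Sum>l\<in>UNIV. (\<Sum>x\<in>UNIV. f x * (V (tr (elt l * (x + d))) * V (tr (elt l * (x - d)))))\<^sup>2) =
      real CARD('a) / 9 * (\<Sum>s\<in>\<F>\<^sub>3. \<Sum>e\<in>\<F>\<^sub>3. (G s e)\<^sup>2) - (G 0 0)\<^sup>2"
  proof -
    have "n \<noteq> j * 1" if "j \<in> \<F>\<^sub>3" for j
      using that n by auto
    from sum_traces_2[OF one_neq_zero this, of "\<lambda>s e. (G s e)\<^sup>2"] show ?thesis
      unfolding G by (subst sum_nonzero) (simp add: tr_0)
  qed
  show ?thesis
    using window_sigma_le[OF \<psi> fd, of "\<lambda>x. V (tr x)"]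
    unfolding sq en K E G0 by (simp add: power2_eq_square[of "real CARD('a)"])
qed

text \<open>On F_3 the difference 0 produces (a^2, b^2, c^2), and the difference 1, for s \<noteq>
  0, produces (bc, ac, ab). The tests isolate the odd part of the first function, its even part
  modulo constants, and then the even and odd parts of the second. The factors 6, 4, 12, 36 count
  contributions over the nine pairs (s, e).\<close>

lemma window_sigma_bounds:
  fixes a b c :: real
  assumes \<psi>: "additive_character \<psi>" "\<exists>x. \<psi> x \<noteq> 1"
  defines "\<sigma> \<equiv> window_sigma \<psi> (window (\<lambda>x::'a. class_value a b c (tr x)))" and "q \<equiv> real CARD('a)"
  shows "\<sigma>\<^sup>2 \<le> q\<^sup>2 / 3 * (b\<^sup>2 - c\<^sup>2)\<^sup>2" (is ?A)
    and "\<sigma>\<^sup>2 \<le> q\<^sup>2 / 9 * (2 * a\<^sup>2 - b\<^sup>2 - c\<^sup>2)\<^sup>2" (is ?B)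
    and "\<sigma>\<^sup>2 \<le> q\<^sup>2 / 9 * (2 * b * c - a * b - a * c)\<^sup>2" (is ?C)
    and "\<sigma>\<^sup>2 \<le> q\<^sup>2 / 3 * (a * b - a * c)\<^sup>2" (is ?D)
proof -
  note t = window_sigma_test[OF \<psi>, where V = "class_value a b c", folded \<sigma>_def q_def]
  have "\<sigma>\<^sup>2 * 2 \<le> q\<^sup>2 / 9 * (6 * (b\<^sup>2 - c\<^sup>2)\<^sup>2)"
    by (rule t[where d = 0 and L = "[(1, 0, 1), (- 1, 0, 2)]"]) (auto simp: power2_eq_square algebra_simps)
  then show ?A by simp
  have "\<sigma>\<^sup>2 * 4 \<le> q\<^sup>2 / 9 * (4 * (2 * a\<^sup>2 - b\<^sup>2 - c\<^sup>2)\<^sup>2)"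
    by (rule t[where d = 0 and L = "[(1, 0, 1), (1, 0, 2), (- 1, 1, 0), (- 1, 2, 0)]"]) (auto simp: power2_eq_square algebra_simps)
  then show ?B by simp
  \<comment> \<open>Weights 2, -1, -1 on j n, j n + 1, j n + 2 cancel at s = 0, where the product
    does not depend on k. With X = 2bc - ab - ac, each s \<noteq> 0 yields 2X at e = 0 and -X at the
    two other e: energy 2 (4 + 1 + 1) X^2 against squared norm 12.\<close>
  have "\<sigma>\<^sup>2 * 12 \<le> q\<^sup>2 / 9 * (12 * (2 * b * c - a * b - a * c)\<^sup>2)"
    by (rule t[where d = 1 and L = "[(2, 1, 0), (2, 2, 0), (- 1, 1, 1), (- 1, 1, 2), (- 1, 2, 1), (- 1, 2, 2)]"])
      (auto simp: power2_eq_square algebra_simps)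
  then show ?C by simp
  \<comment> \<open>Opposite signs on the two cosets select the odd part: nothing at e = 0, and 3
    (ab - ac) up to sign at the four pairs with s and e nonzero, whence 36.\<close>
  have "\<sigma>\<^sup>2 * 12 \<le> q\<^sup>2 / 9 * (36 * (a * b - a * c)\<^sup>2)"
    by (rule t[where d = 1 and L = "[(2, 1, 0), (- 2, 2, 0), (- 1, 1, 1), (- 1, 1, 2), (1, 2, 1), (1, 2, 2)]"])
      (auto simp: power2_eq_square algebra_simps)
  then show ?D by simp
qed
end

section \<open>The lower bound for flat windows\<close>

text \<open>The quadratic form of \<alpha> I + \<gamma> J. The Gram condition is asked only on the
  support of \<open>f\<close>, because a block has no positions d and -d.\<close>

lemma sum_power2_gram:
  fixes w :: "'l \<Rightarrow> 'x::finite \<Rightarrow> real" and f :: "'x \<Rightarrow> complex"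
  assumes gram: "\<And>x y. f x \<noteq> 0 \<Longrightarrow> f y \<noteq> 0 \<Longrightarrow>
    (\<Sum>l\<in>I. w l x * w l y) = (if x = y then \<alpha> + \<gamma> else \<gamma>)"
  shows "(\<Sum>l\<in>I. (cmod (\<Sum>x\<in>UNIV. f x * of_real (w l x)))\<^sup>2) =
    \<alpha> * (\<Sum>x\<in>UNIV. (cmod (f x))\<^sup>2) + \<gamma> * (cmod (\<Sum>x\<in>UNIV. f x))\<^sup>2"
proof -
  have "complex_of_real (\<Sum>l\<in>I. (cmod (\<Sum>x\<in>UNIV. f x * of_real (w l x)))\<^sup>2) =
      (\<Sum>l\<in>I. \<Sum>x\<in>UNIV. \<Sum>y\<in>UNIV. f x * cnj (f y) * of_real (w l x * w l y))"
    unfolding of_real_sum complex_norm_square cnj_sum sum_product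
    by (intro sum.cong refl) simp
  also have "\<dots> = (\<Sum>x\<in>UNIV. \<Sum>y\<in>UNIV. \<Sum>l\<in>I. f x * cnj (f y) * of_real (w l x * w l y))"
    by (subst sum.swap, rule sum.cong[OF refl], rule sum.swap)
  also have "\<dots> = (\<Sum>x\<in>UNIV. \<Sum>y\<in>UNIV. f x * cnj (f y) * of_real (if x = y then \<alpha> + \<gamma> else \<gamma>))"
  proof (intro sum.cong refl)
    fix x y
    show "(\<Sum>l\<in>I. f x * cnj (f y) * of_real (w l x * w l y)) =
        f x * cnj (f y) * of_real (if x = y then \<alpha> + \<gamma> else \<gamma>)"
      using gram[of x y] by (cases "f x = 0 \<or> f y = 0") (auto simp del: of_real_mult simp flip: sum_distrib_left of_real_sum)
  qed
  also have "\<dots> = (\<Sum>x\<in>UNIV. \<Sum>y\<in>UNIV.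
      (if x = y then of_real \<alpha> * (f x * cnj (f y)) else 0) + of_real \<gamma> * (f x * cnj (f y)))"
    by (intro sum.cong refl) (simp add: algebra_simps)
  also have "\<dots> = of_real \<alpha> * (\<Sum>x\<in>UNIV. f x * cnj (f x)) + of_real \<gamma> * ((\<Sum>x\<in>UNIV. f x) * cnj (\<Sum>x\<in>UNIV. f x))"
    by (simp add: sum.distrib sum_product flip: sum_distrib_left)
  also have "\<dots> = complex_of_real (\<alpha> * (\<Sum>x\<in>UNIV. (cmod (f x))\<^sup>2) + \<gamma> * (cmod (\<Sum>x\<in>UNIV. f x))\<^sup>2)"
    by (simp only: of_real_add of_real_mult of_real_sum complex_norm_square)
  finally show ?thesis
    by (simp only: of_real_eq_iff)
qed

text \<open>\<kappa> enters through its quadratic equation, so the Gram identities become polynomial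
  consequences of three equations, within reach of \<open>algebra\<close>. The conjugate root -1 -
  sqrt 2 satisfies them too; only the sign condition in \<open>window_sigma_ge_flat\<close> excludes
  it.\<close>

locale flat_window = ternary_field h F
  for h :: nat and F :: "'a::{field,finite} itself" +
  fixes a b c \<kappa> :: real
  assumes sum_eq_0: "b + c = - a" and prod_eq: "2 * b * c = (3 * \<kappa> - 1) * a\<^sup>2"
    and \<kappa>_eq: "\<kappa>\<^sup>2 = 1 - 2 * \<kappa>"
begin

abbreviation "V \<equiv> class_value a b c :: 'a \<Rightarrow> real"

text \<open>Flatness gives a^2 + b^2 + c^2 = 3 (1 - \<kappa>) a^2 with (1 - \<kappa>)^2 = 2
  \<kappa>^2, and the zero sum makes the sum of fourth powers half the square of this. The three
  lines are the relative positions y = x, y = -x and y independent of x.\<close>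

lemma square_sums:
  "(\<Sum>s\<in>\<F>\<^sub>3. \<Sum>e\<in>\<F>\<^sub>3. V s * V s * (V s * V s)) = 9 * (3 * \<kappa>\<^sup>2 * a ^ 4)"
  "(\<Sum>s\<in>\<F>\<^sub>3. \<Sum>e\<in>\<F>\<^sub>3. V s * V s * (V (2 * s) * V (2 * s))) = 9 * (2 * \<kappa>\<^sup>2 * a ^ 4)"
  "(\<Sum>s\<in>\<F>\<^sub>3. \<Sum>e\<in>\<F>\<^sub>3. V s * V s * (V e * V e)) = 9 * (2 * \<kappa>\<^sup>2 * a ^ 4)"
  by (simp_all, insert sum_eq_0 prod_eq \<kappa>_eq, algebra+)

lemma gram_0:
  assumes "x \<noteq> 0" "y \<noteq> 0"
  shows "(\<Sum>l\<in>UNIV. (V (tr (l * x)) * V (tr (l * x))) * (V (tr (l * y)) * V (tr (l * y)))) =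
    (if x = y then \<kappa>\<^sup>2 * real CARD('a) * a ^ 4 + 2 * \<kappa>\<^sup>2 * real CARD('a) * a ^ 4
     else 2 * \<kappa>\<^sup>2 * real CARD('a) * a ^ 4)"
proof -
  obtain n where n: "n \<notin> \<F>\<^sub>3"
    using ex_notin_prime_field by blast
  \<comment> \<open>n x is a dummy partner of x: in the first two cases only the trace of l x
    matters, but the count is over independent pairs.\<close>
  have nx: "n * x \<noteq> j * x" if "j \<in> \<F>\<^sub>3" for j
    using n that assms(1) by (metis mult_right_cancel)
  consider "y = x" | "y = 2 * x" | "\<And>j. j \<in> \<F>\<^sub>3 \<Longrightarrow> y \<noteq> j * x"
    using assms by (metis empty_iff insert_iff mult_1 mult_zero_left)
  then show ?thesis
  proof cases
    case 1
    then show ?thesis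
      using sum_traces_2[OF assms(1) nx, of "\<lambda>s e. V s * V s * (V s * V s)", unfolded square_sums] by simp
  next
    case 2
    then have "tr (l * y) = 2 * tr (l * x)" for l
      by (simp only: mult.left_commute[of l] tr_double)
    moreover have "x \<noteq> y"
      using 2 assms by auto
    ultimately show ?thesis
      using sum_traces_2[OF assms(1) nx, of "\<lambda>s e. V s * V s * (V (2 * s) * V (2 * s))", unfolded square_sums] by simp
  next
    case 3
    from 3[of 1] have "x \<noteq> y"
      by auto
    with 3 show ?thesis
      using sum_traces_2[OF assms(1) 3, of "\<lambda>s e. V s * V s * (V e * V e)", unfolded square_sums] by simp
  qed
qed

text \<open>The product at position x of block d, with s = tr (l d) and e = tr (l x). For s = 0 it
  is the square of \<open>V e\<close>, otherwise the product of the other two class values.\<close>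

definition pair_value :: "'a \<Rightarrow> 'a \<Rightarrow> real" where
  "pair_value s e = V (e + s) * V (e - s)"

lemma pair_value_simps [simp]:
  "pair_value 0 0 = a * a" "pair_value 0 1 = b * b" "pair_value 0 2 = c * c"
  "pair_value 1 0 = b * c" "pair_value 1 1 = a * c" "pair_value 1 2 = a * b"
  "pair_value 2 0 = b * c" "pair_value 2 1 = a * c" "pair_value 2 2 = a * b"
  by (simp_all add: pair_value_def)

text \<open>One line per relative position of d, x and y. That all off-diagonal positions share one
  value is what flatness achieves. In the last line, the zero sum makes ab + bc + ca equal to -(a^2
  + b^2 + c^2) / 2.\<close>

lemma pair_sums:
  "(\<Sum>s\<in>\<F>\<^sub>3. \<Sum>e\<in>\<F>\<^sub>3. pair_value s 0 * pair_value s 0) = 9 * (2 * \<kappa>\<^sup>2 * a ^ 4)"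
  "(\<Sum>s\<in>\<F>\<^sub>3. \<Sum>e\<in>\<F>\<^sub>3. pair_value s 0 * pair_value s e) = 9 * (\<kappa>\<^sup>2 * a ^ 4)"
  "(\<Sum>s\<in>\<F>\<^sub>3. \<Sum>e\<in>\<F>\<^sub>3. pair_value s e * pair_value s 0) = 9 * (\<kappa>\<^sup>2 * a ^ 4)"
  "(\<Sum>s\<in>\<F>\<^sub>3. \<Sum>e\<in>\<F>\<^sub>3. pair_value s e * pair_value s e) = 9 * (2 * \<kappa>\<^sup>2 * a ^ 4)"
  "(\<Sum>s\<in>\<F>\<^sub>3. \<Sum>e\<in>\<F>\<^sub>3. pair_value s e * pair_value s (e + s)) = 9 * (\<kappa>\<^sup>2 * a ^ 4)"
  "(\<Sum>s\<in>\<F>\<^sub>3. \<Sum>e\<in>\<F>\<^sub>3. pair_value s e * pair_value s (e + 2 * s)) = 9 * (\<kappa>\<^sup>2 * a ^ 4)"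
  "(\<Sum>s\<in>\<F>\<^sub>3. \<Sum>e\<in>\<F>\<^sub>3. pair_value s e * pair_value s (2 * e)) = 9 * (\<kappa>\<^sup>2 * a ^ 4)"
  "(\<Sum>s\<in>\<F>\<^sub>3. \<Sum>e\<in>\<F>\<^sub>3. pair_value s e * pair_value s (2 * e + s)) = 9 * (\<kappa>\<^sup>2 * a ^ 4)"
  "(\<Sum>s\<in>\<F>\<^sub>3. \<Sum>e\<in>\<F>\<^sub>3. pair_value s e * pair_value s (2 * e + 2 * s)) = 9 * (\<kappa>\<^sup>2 * a ^ 4)"
  "(\<Sum>s\<in>\<F>\<^sub>3. \<Sum>e\<in>\<F>\<^sub>3. \<Sum>f\<in>\<F>\<^sub>3. pair_value s e * pair_value s f) = 27 * (\<kappa>\<^sup>2 * a ^ 4)"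
  by (simp_all, insert sum_eq_0 prod_eq \<kappa>_eq, algebra+)

text \<open>With d and -d excluded, 0 is the only multiple of d left. If x is not 0, then y lies in
  the span of d and x, at one of seven positions, or is independent of both.\<close>

lemma gram_nonzero:
  assumes d: "d \<noteq> 0" and x: "x \<noteq> d" "x \<noteq> - d" and y: "y \<noteq> d" "y \<noteq> - d"
  shows "(\<Sum>l\<in>UNIV. (V (tr (l * (x + d))) * V (tr (l * (x - d)))) * (V (tr (l * (y + d))) * V (tr (l * (y - d))))) =
    (if x = y then \<kappa>\<^sup>2 * real CARD('a) * a ^ 4 + \<kappa>\<^sup>2 * real CARD('a) * a ^ 4
     else \<kappa>\<^sup>2 * real CARD('a) * a ^ 4)"
proof -
  have pv: "V (tr (l * (z + d))) * V (tr (l * (z - d))) = pair_value (tr (l * d)) (tr (l * z))" for l z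
    by (simp add: pair_value_def distrib_left right_diff_distrib tr_add tr_diff)
  have md: "- d = 2 * d"
    by (rule minus_eq_double)
  have multiple: "z = 0" if "j \<in> \<F>\<^sub>3" "z = j * d" "z \<noteq> d" "z \<noteq> - d" for j z
    using that md by auto
  have *: "?thesis" if "(\<Sum>l\<in>UNIV. pair_value (tr (l * d)) (tr (l * x)) * pair_value (tr (l * d)) (tr (l * y))) =
    real CARD('a) * (\<kappa>\<^sup>2 * a ^ 4) * (if x = y then 2 else 1)"
    using that unfolding pv by simp
  show ?thesis
  proof (rule *, cases "\<exists>j\<in>\<F>\<^sub>3. x = j * d")
    case True
    then have x0: "x = 0"
      using multiple x by blast
    show "(\<Sum>l\<in>UNIV. pair_value (tr (l * d)) (tr (l * x)) * pair_value (tr (l * d)) (tr (l * y))) =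
      real CARD('a) * (\<kappa>\<^sup>2 * a ^ 4) * (if x = y then 2 else 1)"
    proof (cases "y = 0")
      case True
      obtain n where n: "n \<notin> \<F>\<^sub>3"
        using ex_notin_prime_field by blast
      have nd: "n * d \<noteq> j * d" if "j \<in> \<F>\<^sub>3" for j
        using n that d by (metis mult_right_cancel)
      show ?thesis
        using sum_traces_2[OF d nd, of "\<lambda>s e. pair_value s 0 * pair_value s 0", unfolded pair_sums]
        by (simp add: x0 True tr_0)
    next
      case False
      have yd: "y \<noteq> j * d" if "j \<in> \<F>\<^sub>3" for j
        using multiple[OF that _ y] False by blast
      show ?thesis
        using sum_traces_2[OF d yd, of "\<lambda>s e. pair_value s 0 * pair_value s e", unfolded pair_sums] False
        by (simp add: x0 tr_0)
    qed
  next
    case False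
    then have xd: "x \<noteq> j * d" if "j \<in> \<F>\<^sub>3" for j
      using that by blast
    note pair = sum_traces_2[OF d xd]
    show "(\<Sum>l\<in>UNIV. pair_value (tr (l * d)) (tr (l * x)) * pair_value (tr (l * d)) (tr (l * y))) =
      real CARD('a) * (\<kappa>\<^sup>2 * a ^ 4) * (if x = y then 2 else 1)"
    proof (cases "\<exists>j\<in>\<F>\<^sub>3. \<exists>k\<in>\<F>\<^sub>3. y = j * d + k * x")
      case True
      then obtain j k where jk: "j \<in> \<F>\<^sub>3" "k \<in> \<F>\<^sub>3" and y': "y = j * d + k * x"
        by blast
      have "l * y = j * (l * d) + k * (l * x)" for l
        by (simp add: y' algebra_simps)
      then have tr_y: "tr (l * y) = k * tr (l * x) + j * tr (l * d)" for l
        using jk by (simp only: tr_add tr_mult_prime_field add.commute)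
      have ne: "x \<noteq> y" if "k \<noteq> 1 \<or> j \<noteq> 0"
      proof
        assume "x = y"
        then have "x / d = (j * d + k * x) / d"
          using y' by simp
        moreover have "(j * d + k * x) / d = k * (x / d) + j"
          using d by (simp add: add_divide_distrib)
        ultimately have "1 * (x / d) + 0 = k * (x / d) + j"
          by (simp only: mult_1 add_0_right)
        moreover have "x / d \<notin> \<F>\<^sub>3"
          using xd[of "x / d"] d by (auto simp del: insert_iff)
        ultimately show False
          using combination_inject[of "x / d" 1 0 k j] jk that by blast
      qed
      have k0: "j = 0" if "k = 0"
        using multiple[of j y] jk y that d by (simp add: y')
      consider "k = 0" "j = 0" | "k = 1" "j = 0" | "k = 1" "j = 1" | "k = 1" "j = 2"
        | "k = 2" "j = 0" | "k = 2" "j = 1" | "k = 2" "j = 2"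
        using jk k0 by blast
      then show ?thesis
      proof cases
        case 1 then show ?thesis
          using pair[of "\<lambda>s e. pair_value s e * pair_value s 0", unfolded pair_sums] ne by (simp add: tr_y)
      next
        case 2 then show ?thesis
          using pair[of "\<lambda>s e. pair_value s e * pair_value s e", unfolded pair_sums] by (simp add: y')
      next
        case 3 then show ?thesis
          using pair[of "\<lambda>s e. pair_value s e * pair_value s (e + s)", unfolded pair_sums] ne by (simp add: tr_y)
      next
        case 4 then show ?thesis
          using pair[of "\<lambda>s e. pair_value s e * pair_value s (e + 2 * s)", unfolded pair_sums] ne by (simp add: tr_y)
      next
        case 5 then show ?thesis
          using pair[of "\<lambda>s e. pair_value s e * pair_value s (2 * e)", unfolded pair_sums] ne by (simp add: tr_y)
      next
        case 6 then show ?thesis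
          using pair[of "\<lambda>s e. pair_value s e * pair_value s (2 * e + s)", unfolded pair_sums] ne by (simp add: tr_y)
      next
        case 7 then show ?thesis
          using pair[of "\<lambda>s e. pair_value s e * pair_value s (2 * e + 2 * s)", unfolded pair_sums] ne by (simp add: tr_y)
      qed
    next
      case False
      then have yx: "y \<noteq> j * d + k * x" if "j \<in> \<F>\<^sub>3" "k \<in> \<F>\<^sub>3" for j k
        using that by blast
      from yx[of 0 1] have "x \<noteq> y"
        by auto
      then show ?thesis
        using sum_traces_3[OF d xd yx, of "\<lambda>s e f. pair_value s e * pair_value s f", unfolded pair_sums] by simp
    qed
  qed
qed

lemma window_sigma_ge_flat:
  assumes \<psi>: "additive_character \<psi>" "\<exists>x. \<psi> x \<noteq> 1" and \<kappa>: "0 \<le> \<kappa>" "1 \<le> \<kappa>\<^sup>2 * real CARD('a)"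
  shows "\<kappa> * real CARD('a) * a\<^sup>2 \<le> window_sigma \<psi> (window (\<lambda>x. V (tr x)))"
proof (rule window_sigma_ge[OF \<psi>])
  show "0 \<le> \<kappa> * real CARD('a) * a\<^sup>2"
    using \<kappa> by simp
next
  fix d and f :: "'a \<Rightarrow> complex"
  assume f: "f d = 0" "f (- d) = 0"
  define w where "w l x = V (tr (l * (x + d))) * V (tr (l * (x - d)))" for l x
  define \<alpha> where "\<alpha> = \<kappa>\<^sup>2 * real CARD('a) * a ^ 4"
  define \<gamma> where "\<gamma> = (if d = 0 then 2 * \<alpha> else \<alpha>)"
  have \<alpha>: "a ^ 4 \<le> \<alpha>"
    using mult_right_mono[OF \<kappa>(2), of "a ^ 4"] by (simp add: \<alpha>_def)
  moreover have "0 \<le> \<alpha>"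
    by (rule order.trans[OF _ \<alpha>]) simp
  ultimately have \<gamma>: "a ^ 4 \<le> \<gamma>"
    by (simp add: \<gamma>_def)
  have gram: "(\<Sum>l\<in>UNIV. w l x * w l y) = (if x = y then \<alpha> + \<gamma> else \<gamma>)" if "f x \<noteq> 0" "f y \<noteq> 0" for x y
  proof (cases "d = 0")
    case True
    with that f have "x \<noteq> 0" "y \<noteq> 0"
      by auto
    from gram_0[OF this] True show ?thesis
      by (simp add: w_def \<alpha>_def \<gamma>_def mult.assoc)
  next
    case False
    have "x \<noteq> d" "x \<noteq> - d" "y \<noteq> d" "y \<noteq> - d"
      using that f by auto
    from gram_nonzero[OF False this] False show ?thesis
      by (simp add: w_def \<alpha>_def \<gamma>_def)
  qed
  have "(\<Sum>l\<in>UNIV. (cmod (\<Sum>x\<in>UNIV. f x * of_real (w (elt l) x)))\<^sup>2) =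
      (\<Sum>l\<in>UNIV. (cmod (\<Sum>x\<in>UNIV. f x * of_real (w l x)))\<^sup>2) -
      (cmod (\<Sum>x\<in>UNIV. f x * of_real (w 0 x)))\<^sup>2"
    by (rule sum_nonzero)
  also have "\<dots> = \<alpha> * (\<Sum>x\<in>UNIV. (cmod (f x))\<^sup>2) + (\<gamma> - a ^ 4) * (cmod (\<Sum>x\<in>UNIV. f x))\<^sup>2"
  proof -
    have "(\<Sum>l\<in>UNIV. (cmod (\<Sum>x\<in>UNIV. f x * of_real (w l x)))\<^sup>2) =
        \<alpha> * (\<Sum>x\<in>UNIV. (cmod (f x))\<^sup>2) + \<gamma> * (cmod (\<Sum>x\<in>UNIV. f x))\<^sup>2"
      by (rule sum_power2_gram) (rule gram)
    moreover have "(\<Sum>x\<in>UNIV. f x * of_real (w 0 x)) = (\<Sum>x\<in>UNIV. f x) * of_real (a * a)"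
      by (simp add: w_def tr_0 sum_distrib_right)
    then have "(cmod (\<Sum>x\<in>UNIV. f x * of_real (w 0 x)))\<^sup>2 = a ^ 4 * (cmod (\<Sum>x\<in>UNIV. f x))\<^sup>2"
      by (simp add: norm_mult power2_eq_square power4_eq_xxxx)
    ultimately show ?thesis
      by (simp only: left_diff_distrib add_diff_eq)
  qed
  finally have "\<alpha> * (\<Sum>x\<in>UNIV. (cmod (f x))\<^sup>2) \<le>
      (\<Sum>l\<in>UNIV. (cmod (\<Sum>x\<in>UNIV. f x * of_real (w (elt l) x)))\<^sup>2)"
    using \<gamma> by simp
  then have "real CARD('a) * (\<alpha> * (\<Sum>x\<in>UNIV. (cmod (f x))\<^sup>2)) \<le>
      real CARD('a) * (\<Sum>l\<in>UNIV. (cmod (\<Sum>x\<in>UNIV. f x * of_real (w (elt l) x)))\<^sup>2)"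
    by (rule mult_left_mono) simp
  moreover have "(\<kappa> * real CARD('a) * a\<^sup>2)\<^sup>2 = real CARD('a) * \<alpha>"
    by (simp add: \<alpha>_def power_mult_distrib power2_eq_square power4_eq_xxxx)
  ultimately show "(\<kappa> * real CARD('a) * a\<^sup>2)\<^sup>2 * (\<Sum>x\<in>UNIV. (cmod (f x))\<^sup>2) \<le> real CARD('a) *
      (\<Sum>l\<in>UNIV. (cmod (\<Sum>x\<in>UNIV. f x * of_real (V (tr (elt l * (x + d))) * V (tr (elt l * (x - d))))))\<^sup>2)"
    by (simp only: w_def mult.assoc)
qed

end

section \<open>Maximizing windows\<close>

context ternary_field begin

definition trace_window :: "real \<Rightarrow> real \<Rightarrow> real \<Rightarrow> real ^ 'a nonzero" where
  "trace_window a b c = window (\<lambda>x. class_value a b c (tr x))"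

lemma trace_window_nth [simp]: "trace_window a b c $ m = class_value a b c (tr (elt m))"
  by (simp add: trace_window_def window_def)

lemma norm_trace_window:
  "(norm (trace_window a b c))\<^sup>2 = (real CARD('a) / 3 - 1) * a\<^sup>2 + real CARD('a) / 3 * (b\<^sup>2 + c\<^sup>2)"
proof -
  \<comment> \<open>The norm involves one trace only; n supplies the independent second argument for
    \<open>sum_traces_2\<close>.\<close>
  obtain n where "n \<notin> \<F>\<^sub>3"
    using ex_notin_prime_field by blast
  then have "n \<noteq> j * 1" if "j \<in> \<F>\<^sub>3" for j
    using that by auto
  from sum_traces_2[OF one_neq_zero this, of "\<lambda>s e. (class_value a b c s)\<^sup>2"]
  have "(\<Sum>l\<in>UNIV. (class_value a b c (tr l))\<^sup>2) = real CARD('a) / 3 * (a\<^sup>2 + b\<^sup>2 + c\<^sup>2)"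
    by (simp add: algebra_simps)
  then show ?thesis
    by (simp add: norm_vec_power2 sum_nonzero[of "\<lambda>x. (class_value a b c (tr x))\<^sup>2"] tr_0 algebra_simps)
qed

lemma trace_windows_eq: "trace_windows h = {trace_window a b c |a b c. norm (trace_window a b c) = 1}"
proof (intro equalityI subsetI)
  fix \<phi> :: "real ^ 'a nonzero"
  assume \<phi>: "\<phi> \<in> trace_windows h"
  then obtain a b c where "\<forall>m\<in>trace_class h 0. \<phi> $ m = a" "\<forall>m\<in>trace_class h 1. \<phi> $ m = b"
    "\<forall>m\<in>trace_class h 2. \<phi> $ m = c"
    by (auto simp: trace_windows_def)
  then have "\<phi> $ m = trace_window a b c $ m" for m
    using tr_in_prime_field[of "elt m"] by (auto simp: trace_class_def)
  then have "\<phi> = trace_window a b c"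
    by (simp add: vec_eq_iff)
  with \<phi> show "\<phi> \<in> {trace_window a b c |a b c. norm (trace_window a b c) = 1}"
    by (auto simp: trace_windows_def)
qed (auto simp: trace_windows_def trace_class_def)

lemma uminus_trace_window: "- trace_window a b c = trace_window (- a) (- b) (- c)"
  by (simp add: vec_eq_iff class_value_def)

lemma reflect_trace_window: "reflect (trace_window a b c) = trace_window a c b"
proof -
  have "class_value a b c (- tr x) = class_value a c b (tr x)" for x
    using tr_in_prime_field[of x] by auto
  then show ?thesis
    by (simp add: vec_eq_iff reflect_def uminus_nonzero.rep_eq tr_minus)
qed

lemma trace_flat_window_eq:
  defines "N \<equiv> sqrt (real CARD('a) * (2 - sqrt 2) - 1)"
  shows "trace_flat_window h = trace_window (1 / N) (window_ratio / N) ((- 1 - window_ratio) / N)"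
  by (auto simp: vec_eq_iff trace_flat_window_def trace_class_def class_value_def N_def)

text \<open>The product equation for b = r a and c = (-1 - r) a, that is -2 r (r + 1) = 3 \<kappa> -
  1.\<close>

lemma window_ratio: "window_ratio * window_ratio + window_ratio = (1 - 3 * (sqrt 2 - 1)) / 2"
proof -
  have "sqrt 2 \<le> 3 / 2"
    by (rule real_le_lsqrt) (simp_all add: power2_eq_square)
  then have "sqrt (9 - 6 * sqrt 2) * sqrt (9 - 6 * sqrt 2) = 9 - 6 * sqrt 2"
    by simp
  then show ?thesis
    by (simp add: window_ratio_def field_simps)
qed

definition \<kappa> :: real where "\<kappa> = sqrt 2 - 1"
definition N_q :: real where "N_q = real CARD('a) * (2 - sqrt 2) - 1"

lemma \<kappa>: "\<kappa> * \<kappa> = 1 - 2 * \<kappa>" "0 < \<kappa>" "\<kappa> < 1 / 2"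
  using real_le_lsqrt[of 2 "3 / 2"] real_less_lsqrt[of "3 / 2" 2]
  by (auto simp: \<kappa>_def algebra_simps power2_eq_square)

lemma card_ge_9: "9 \<le> real CARD('a)"
proof -
  have "3 ^ 2 \<le> CARD('a)"
    unfolding card_F using h_ge_2 by (intro power_increasing) auto
  then show ?thesis
    by simp
qed

text \<open>Used on both sides: it is \<theta> \<le> 1/6 in the extremal problem, and \<gamma> \<ge>
  a^4 for flat windows. It fails for q = 3.\<close>

lemma card_\<kappa>: "1 \<le> real CARD('a) * (\<kappa> * \<kappa>)"
proof -
  \<comment> \<open>13/9 is exactly the bound that makes \<kappa>^2 = 3 - 2 sqrt 2 at least
    1/9.\<close>
  have "sqrt 2 \<le> 13 / 9"
    by (rule real_le_lsqrt) (simp_all add: power2_eq_square)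
  then have "1 / 9 \<le> \<kappa> * \<kappa>"
    unfolding \<kappa>(1) by (simp add: \<kappa>_def)
  from mult_mono[OF card_ge_9 this] show ?thesis
    by simp
qed

lemma N_q: "N_q = real CARD('a) * (1 - \<kappa>) - 1" "0 < N_q"
proof -
  show N_q: "N_q = real CARD('a) * (1 - \<kappa>) - 1"
    by (simp add: N_q_def \<kappa>_def)
  have "9 * (1 / 2) \<le> real CARD('a) * (1 - \<kappa>)"
    using card_ge_9 \<kappa> by (intro mult_mono) auto
  then show "0 < N_q"
    by (simp add: N_q)
qed

lemma flat_norm:
  assumes "b + c = - a" "2 * b * c = (3 * \<kappa> - 1) * a\<^sup>2"
  shows "(norm (trace_window a b c))\<^sup>2 = N_q * a\<^sup>2"
proof -
  have "b\<^sup>2 + c\<^sup>2 = (2 - 3 * \<kappa>) * a\<^sup>2"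
    using assms by algebra
  then show ?thesis
    unfolding norm_trace_window N_q(1) by (simp only:) (simp add: field_simps)
qed

section \<open>The maximal value and the equations of its maximizers\<close>

context
  fixes \<psi> :: "'a \<Rightarrow> complex"
  assumes \<psi>: "additive_character \<psi>" "\<exists>x. \<psi> x \<noteq> 1"
begin

lemmas trace_window_bounds = window_sigma_bounds[OF \<psi>, folded trace_window_def]

text \<open>Dividing the four test bounds by a^2 leaves two unknown ratios, p and \<mu>, and turns
  the hypothesis into the premises of \<open>extremal_ratios\<close>.\<close>

lemma flat_if_window_sigma_ge:
  assumes norm: "norm (trace_window a b c) = 1"
    and ge: "real CARD('a) * \<kappa> / N_q \<le> window_sigma \<psi> (trace_window a b c)"
  shows "b + c = - a" and "2 * b * c = (3 * \<kappa> - 1) * a\<^sup>2"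
proof -
  define q where "q = real CARD('a)"
  have q: "0 < q" and N0: "0 < N_q"
    using card_ge_9 N_q(2) by (simp_all add: q_def)
  have le: "\<kappa> / N_q \<le> \<bar>y\<bar> / t" if "(window_sigma \<psi> (trace_window a b c))\<^sup>2 \<le> q\<^sup>2 / t\<^sup>2 * y\<^sup>2" "0 < t" for y t
  proof -
    have "(q * \<kappa> / N_q)\<^sup>2 \<le> (q * y / t)\<^sup>2"
      using power_mono[OF ge, of 2] that N0 q \<kappa>(2) by (simp add: q_def power_mult_distrib power_divide)
    then have "q * \<kappa> / N_q \<le> \<bar>q * y / t\<bar>"
      by (rule power2_le_imp_le[of "q * \<kappa> / N_q" "\<bar>q * y / t\<bar>", simplified power2_abs]) simp
    then have "q * (\<kappa> / N_q) \<le> q * (\<bar>y\<bar> / t)"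
      using q that(2) by (simp add: abs_mult)
    then show ?thesis
      by (rule mult_left_le_imp_le) (rule q)
  qed
  have A: "\<kappa> / N_q \<le> \<bar>b\<^sup>2 - c\<^sup>2\<bar> / sqrt 3"
    using trace_window_bounds(1)[of a b c] by (intro le) (simp_all add: q_def)
  have B: "\<kappa> / N_q \<le> \<bar>2 * a\<^sup>2 - b\<^sup>2 - c\<^sup>2\<bar> / 3"
    using trace_window_bounds(2)[of a b c] by (intro le) (simp_all add: q_def)
  have C: "\<kappa> / N_q \<le> \<bar>2 * b * c - a * b - a * c\<bar> / 3"
    using trace_window_bounds(3)[of a b c] by (intro le) (simp_all add: q_def)
  have D: "\<kappa> / N_q \<le> \<bar>a * b - a * c\<bar> / sqrt 3"
    using trace_window_bounds(4)[of a b c] by (intro le) (simp_all add: q_def)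
  have a: "a \<noteq> 0"
    using D divide_pos_pos[OF \<kappa>(2) N0] by auto
  \<comment> \<open>By the normalization 1 / a^2 = q/3 - 1 + (q/6) Y is affine in Y, and so is the
    scaled target \<kappa> / (N_q a^2). Its slope is \<theta>, and it equals \<kappa> at Y = 4 - 6
    \<kappa>.\<close>
  define p \<mu> \<theta> where "p = (b + c) / a" and "\<mu> = \<bar>b - c\<bar> / (sqrt 3 * \<bar>a\<bar>)" and "\<theta> = \<kappa> * q / (6 * N_q)"
  have \<mu>2: "3 * \<mu>\<^sup>2 = (b - c)\<^sup>2 / a\<^sup>2"
    by (simp add: \<mu>_def power_divide power_mult_distrib)
  define Y where "Y = p\<^sup>2 + 3 * \<mu>\<^sup>2"
  have Y: "Y / 2 = (b\<^sup>2 + c\<^sup>2) / a\<^sup>2"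
    unfolding Y_def \<mu>2 p_def using a by (simp add: field_simps power2_eq_square)
  have inv: "q / 3 - 1 + q / 6 * Y = 1 / a\<^sup>2"
  proof -
    have "(q / 3 - 1) * a\<^sup>2 + q / 3 * (b\<^sup>2 + c\<^sup>2) = 1"
      using norm_trace_window[of a b c] norm by (simp add: q_def)
    then have "((q / 3 - 1) * a\<^sup>2 + q / 3 * (b\<^sup>2 + c\<^sup>2)) / a\<^sup>2 = 1 / a\<^sup>2"
      by (rule arg_cong)
    then have "(q / 3 - 1) + q / 3 * ((b\<^sup>2 + c\<^sup>2) / a\<^sup>2) = 1 / a\<^sup>2"
      using a by (simp add: add_divide_distrib[of "(q / 3 - 1) * a\<^sup>2"])
    then show ?thesis
      unfolding Y[symmetric] by simp
  qed
  have f: "\<kappa> + \<theta> * (Y - (4 - 6 * \<kappa>)) = \<kappa> / N_q / a\<^sup>2"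
  proof -
    have "\<kappa> + \<theta> * (Y - (4 - 6 * \<kappa>)) = \<kappa> / N_q * (N_q - q / 6 * (4 - 6 * \<kappa>) + q / 6 * Y)"
      using N0 by (simp add: \<theta>_def field_simps)
    also have "N_q - q / 6 * (4 - 6 * \<kappa>) + q / 6 * Y = 1 / a\<^sup>2"
      unfolding inv[symmetric] N_q(1) q_def[symmetric] by (simp add: field_simps)
    finally show ?thesis
      by simp
  qed
  have scale: "\<kappa> / N_q / a\<^sup>2 \<le> \<bar>y / a\<^sup>2\<bar> / t" if "\<kappa> / N_q \<le> \<bar>y\<bar> / t" for y t
    using divide_right_mono[OF that, of "a\<^sup>2"] by (simp add: mult.commute)
  have "p = - 1 \<and> \<mu> = \<kappa>"
    unfolding \<kappa>_def
  proof (rule extremal_ratios[where \<theta> = \<theta>], unfold \<kappa>_def[symmetric] Y_def[symmetric] f)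
    \<comment> \<open>Since 1 - \<kappa> = sqrt 2 \<kappa>, strictness is due to the -1 in
      \<open>N_q\<close>, the contribution of the missing point 0.\<close>
    show "1 / (6 * sqrt 2) < \<theta>"
    proof -
      have "(1 - \<kappa>) = sqrt 2 * \<kappa>"
        by (simp add: \<kappa>_def algebra_simps)
      then have "N_q < sqrt 2 * \<kappa> * q"
        unfolding N_q(1) by (simp add: q_def)
      then show ?thesis
        using N0 by (simp add: \<theta>_def field_simps)
    qed
    show "\<theta> \<le> 1 / 6"
      using N0 card_\<kappa> unfolding \<kappa>(1) by (simp add: \<theta>_def field_simps q_def N_q(1))
    show "0 \<le> \<mu>"
      by (simp add: \<mu>_def)
    have "\<bar>p\<bar> * \<mu> = \<bar>(b\<^sup>2 - c\<^sup>2) / a\<^sup>2\<bar> / sqrt 3"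
      by (simp add: p_def \<mu>_def power2_eq_square square_diff_square_factored abs_mult)
    then show "\<kappa> / N_q / a\<^sup>2 \<le> \<bar>p\<bar> * \<mu>"
      using scale[OF A] by simp
    have "\<mu> = \<bar>(a * b - a * c) / a\<^sup>2\<bar> / sqrt 3"
      using a by (simp add: \<mu>_def power2_eq_square abs_mult flip: right_diff_distrib)
    then show "\<kappa> / N_q / a\<^sup>2 \<le> \<mu>"
      using scale[OF D] by simp
    have "2 - Y / 2 = (2 * a\<^sup>2 - b\<^sup>2 - c\<^sup>2) / a\<^sup>2"
      unfolding Y using a by (simp add: field_simps)
    then show "3 * (\<kappa> / N_q / a\<^sup>2) \<le> \<bar>2 - Y / 2\<bar>"
      using scale[OF B] by simp
    have "(p\<^sup>2 - 3 * \<mu>\<^sup>2) / 2 - p = (2 * b * c - a * b - a * c) / a\<^sup>2"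
      unfolding \<mu>2 p_def using a by (simp add: field_simps power2_eq_square)
    then show "3 * (\<kappa> / N_q / a\<^sup>2) \<le> \<bar>(p\<^sup>2 - 3 * \<mu>\<^sup>2) / 2 - p\<bar>"
      using scale[OF C] by simp
  qed
  then have p: "p = - 1" and \<mu>: "\<mu> = \<kappa>"
    by simp_all
  show bc: "b + c = - a"
    using p a by (simp add: p_def field_simps)
  have "(b - c)\<^sup>2 = 3 * (\<kappa> * \<kappa>) * a\<^sup>2"
    using \<mu>2 a unfolding \<mu> by (simp add: field_simps power2_eq_square)
  with bc show "2 * b * c = (3 * \<kappa> - 1) * a\<^sup>2"
    unfolding \<kappa>(1) by algebra
qed

lemma window_sigma_flat:
  assumes norm: "norm (trace_window a b c) = 1"
    and flat: "b + c = - a" "2 * b * c = (3 * \<kappa> - 1) * a\<^sup>2"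
  shows "window_sigma \<psi> (trace_window a b c) = real CARD('a) * \<kappa> / N_q"
proof -
  have "N_q * a\<^sup>2 = 1"
    using flat_norm[OF flat] norm by simp
  then have a2: "a\<^sup>2 = 1 / N_q"
    using N_q(2) by (simp add: field_simps)
  interpret flat_window h F a b c \<kappa>
    by unfold_locales (use flat \<kappa>(1) in \<open>simp_all add: power2_eq_square\<close>)
  have "real CARD('a) * \<kappa> / N_q \<le> window_sigma \<psi> (trace_window a b c)"
    using window_sigma_ge_flat[OF \<psi>] \<kappa>(2) card_\<kappa> a2
    by (simp add: trace_window_def power2_eq_square mult.commute)
  \<comment> \<open>Any of the four tests would do, since their bounds coincide for a flat
    window.\<close>
  moreover have "window_sigma \<psi> (trace_window a b c) \<le> real CARD('a) * \<kappa> / N_q"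
  proof (rule power2_le_imp_le)
    have "(b\<^sup>2 - c\<^sup>2)\<^sup>2 = 3 * \<kappa>\<^sup>2 * (a\<^sup>2)\<^sup>2"
      using flat \<kappa>(1) by algebra
    then show "(window_sigma \<psi> (trace_window a b c))\<^sup>2 \<le> (real CARD('a) * \<kappa> / N_q)\<^sup>2"
      using trace_window_bounds(1)[of a b c] by (simp add: a2 power_divide power_mult_distrib)
  qed (use N_q(2) \<kappa>(2) in simp)
  ultimately show ?thesis
    by simp
qed

text \<open>A window reaching at least the value is flat, and a flat window has exactly the
  value.\<close>

lemma window_sigma_le_flat:
  assumes "norm (trace_window a b c) = 1"
  shows "window_sigma \<psi> (trace_window a b c) \<le> real CARD('a) * \<kappa> / N_q"
  using assms flat_if_window_sigma_ge window_sigma_flat by (metis linorder_le_cases)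



end

section \<open>The four flat unit vectors\<close>

lemma trace_flat_window_flat:
  fixes a b c :: real
  defines "a \<equiv> 1 / sqrt N_q" and "b \<equiv> window_ratio / sqrt N_q" and "c \<equiv> (- 1 - window_ratio) / sqrt N_q"
  shows "trace_flat_window h = trace_window a b c" and "b + c = - a" and "2 * b * c = (3 * \<kappa> - 1) * a\<^sup>2"
    and "norm (trace_window a b c) = 1"
proof -
  show "trace_flat_window h = trace_window a b c"
    unfolding trace_flat_window_eq a_def b_def c_def N_q_def ..
  show bc: "b + c = - a"
    by (simp add: a_def b_def c_def flip: add_divide_distrib)
  have a2: "a\<^sup>2 = 1 / N_q"
    using N_q(2) by (simp add: a_def power_divide)
  have "2 * b * c = - (2 * (window_ratio * window_ratio + window_ratio)) / N_q"
    using N_q(2) by (simp add: b_def c_def field_simps)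
  then show "2 * b * c = (3 * \<kappa> - 1) * a\<^sup>2"
    unfolding window_ratio a2 \<kappa>_def[symmetric] using N_q(2) by (simp add: field_simps)
  from flat_norm[OF bc this] have "(norm (trace_window a b c))\<^sup>2 = 1"
    using N_q(2) by (simp add: a2)
  then show "norm (trace_window a b c) = 1"
    using norm_ge_zero[of "trace_window a b c"] by (auto simp: power2_eq_1_iff simp del: norm_ge_zero)
qed

lemma flat_windows_eq:
  "{trace_window a b c |a b c.
      norm (trace_window a b c) = 1 \<and> b + c = - a \<and> 2 * b * c = (3 * \<kappa> - 1) * a\<^sup>2} =
    {trace_flat_window h, - trace_flat_window h,
     reflect (trace_flat_window h), - reflect (trace_flat_window h)}" (is "?L = ?R")
proof (intro equalityI subsetI)
  define n where "n = sqrt N_q"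
  have n: "n \<noteq> 0" "n\<^sup>2 = N_q"
    using N_q(2) by (simp_all add: n_def)
  note flat = trace_flat_window_flat[folded n_def]
  fix \<phi>
  assume "\<phi> \<in> ?L"
  then obtain a b c where \<phi>: "\<phi> = trace_window a b c" and norm: "norm (trace_window a b c) = 1"
    and bc: "b + c = - a" "2 * b * c = (3 * \<kappa> - 1) * a\<^sup>2"
    by blast
  have "(n * a - 1) * (n * a + 1) = 0"
    using flat_norm[OF bc] norm n(2) by (simp add: algebra_simps power2_eq_square)
  then have "n * a = 1 \<or> n * a = - 1"
    unfolding mult_eq_0_iff by auto
  then have a: "a = 1 / n \<or> a = - 1 / n"
    using n(1) by (auto simp: field_simps)
  \<comment> \<open>b and c have prescribed sum and product, so they are the roots r a and (-1 - r)
    a in some order; the order is the reflection, the sign of a the global sign.\<close>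
  have "b * b + a * b = (window_ratio * window_ratio + window_ratio) * a\<^sup>2"
    unfolding window_ratio \<kappa>_def[symmetric] using bc by algebra
  then have "(b - window_ratio * a) * (b - (- 1 - window_ratio) * a) = 0"
    by (simp add: algebra_simps power2_eq_square)
  then have "b = window_ratio * a \<or> b = (- 1 - window_ratio) * a"
    by auto
  moreover have "c = - a - b"
    using bc(1) by simp
  ultimately have "b = window_ratio * a \<and> c = (- 1 - window_ratio) * a \<or>
      b = (- 1 - window_ratio) * a \<and> c = window_ratio * a"
    by (auto simp: algebra_simps)
  with a show "\<phi> \<in> ?R"
    unfolding \<phi> flat(1) reflect_trace_window uminus_trace_window by auto
next
  have mem: "trace_window a b c \<in> ?L"
    if flat: "b + c = - a" "2 * b * c = (3 * \<kappa> - 1) * a\<^sup>2" and "N_q * a\<^sup>2 = 1" for a b c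
  proof -
    have "(norm (trace_window a b c))\<^sup>2 = 1"
      using flat_norm[OF flat] that(3) by simp
    then have "norm (trace_window a b c) = 1"
      using norm_ge_zero[of "trace_window a b c"] by (auto simp: power2_eq_1_iff simp del: norm_ge_zero)
    with flat show ?thesis
      by blast
  qed
  obtain a b c where eq: "trace_flat_window h = trace_window a b c" and norm: "norm (trace_window a b c) = 1"
    and flat: "b + c = - a" "2 * b * c = (3 * \<kappa> - 1) * a\<^sup>2"
    using trace_flat_window_flat by blast
  have a: "N_q * a\<^sup>2 = 1"
    using flat_norm[OF flat] norm by simp
  fix \<phi>
  assume "\<phi> \<in> ?R"
  then consider "\<phi> = trace_window a b c" | "\<phi> = trace_window (- a) (- b) (- c)"
    | "\<phi> = trace_window a c b" | "\<phi> = trace_window (- a) (- c) (- b)"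
    unfolding eq reflect_trace_window uminus_trace_window by blast
  then show "\<phi> \<in> ?L"
  proof cases
    case 1
    then show ?thesis
      using mem[OF flat a] by simp
  next
    case 2
    then show ?thesis
      using mem[of "- b" "- c" "- a"] flat a by simp
  next
    case 3
    then show ?thesis
      using mem[of c b a] flat a by (simp add: add.commute mult.commute mult.left_commute)
  next
    case 4
    then show ?thesis
      using mem[of "- c" "- b" "- a"] flat a by (simp add: algebra_simps)
  qed
qed

end

theorem theorem6p15:
  fixes \<psi> :: "'a::{field,finite} \<Rightarrow> complex" and h q :: nat
  assumes "h \<ge> 2" and "q = 3 ^ h" and "CARD('a) = q"
    and "additive_character \<psi>" and "\<exists>x. \<psi> x \<noteq> 1"
  shows "(\<exists>\<phi>\<in>trace_windows h.
            window_sigma \<psi> \<phi> = real q * (sqrt 2 - 1) / (real q * (2 - sqrt 2) - 1))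
       \<and> (\<forall>\<phi>\<in>trace_windows h.
            window_sigma \<psi> \<phi> \<le> real q * (sqrt 2 - 1) / (real q * (2 - sqrt 2) - 1))
       \<and> {\<phi> \<in> trace_windows h.
            window_sigma \<psi> \<phi> = real q * (sqrt 2 - 1) / (real q * (2 - sqrt 2) - 1)}
          = {trace_flat_window h, - trace_flat_window h,
             reflect (trace_flat_window h), - reflect (trace_flat_window h)}
       \<and> (\<forall>\<phi>. is_arg_max (window_sigma \<psi>) (\<lambda>\<phi>. \<phi> \<in> trace_windows h) \<phi> \<longrightarrow>
            (\<forall>m0\<in>trace_class h 0. \<forall>m1\<in>trace_class h 1. \<forall>m2\<in>trace_class h 2.
               \<phi> $ m0 + \<phi> $ m1 + \<phi> $ m2 = 0))"
proof -
  interpret ternary_field h "TYPE('a)"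
    using assms(1-3) by unfold_locales simp_all
  note \<psi> = assms(4,5)
  define \<sigma> where "\<sigma> = real q * (sqrt 2 - 1) / (real q * (2 - sqrt 2) - 1)"
  have \<sigma>: "\<sigma> = real CARD('a) * \<kappa> / N_q"
    by (simp add: \<sigma>_def \<kappa>_def N_q_def assms(3))
  have le: "window_sigma \<psi> \<phi> \<le> \<sigma>" if "\<phi> \<in> trace_windows h" for \<phi>
    using that window_sigma_le_flat[OF \<psi>] unfolding trace_windows_eq \<sigma> by blast
  have max: "\<phi> \<in> trace_windows h \<and> window_sigma \<psi> \<phi> = \<sigma> \<longleftrightarrow>
      (\<exists>a b c. \<phi> = trace_window a b c \<and> norm (trace_window a b c) = 1 \<and>
        b + c = - a \<and> 2 * b * c = (3 * \<kappa> - 1) * a\<^sup>2)" for \<phi>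
    unfolding trace_windows_eq \<sigma>
    using flat_if_window_sigma_ge[OF \<psi>] window_sigma_flat[OF \<psi>]
    by (smt (verit, ccfv_threshold) mem_Collect_eq)
  have set: "{\<phi> \<in> trace_windows h. window_sigma \<psi> \<phi> = \<sigma>} =
      {trace_flat_window h, - trace_flat_window h, reflect (trace_flat_window h), - reflect (trace_flat_window h)}"
    unfolding flat_windows_eq[symmetric] max by blast
  have "trace_flat_window h \<in> {\<phi> \<in> trace_windows h. window_sigma \<psi> \<phi> = \<sigma>}"
    unfolding set by simp
  then have flat: "(trace_flat_window h :: real ^ 'a nonzero) \<in> trace_windows h" "window_sigma \<psi> (trace_flat_window h) = \<sigma>"
    by simp_all
  have "\<phi> $ m0 + \<phi> $ m1 + \<phi> $ m2 = 0"
    if "is_arg_max (window_sigma \<psi>) (\<lambda>\<phi>. \<phi> \<in> trace_windows h) \<phi>"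
      and m: "m0 \<in> trace_class h 0" "m1 \<in> trace_class h 1" "m2 \<in> trace_class h 2" for \<phi> m0 m1 m2
  proof -
    \<comment> \<open>The value is attained at the trace-flat window, so an arg max cannot stay
      below it.\<close>
    have "\<phi> \<in> trace_windows h \<and> window_sigma \<psi> \<phi> = \<sigma>"
      using that(1) flat le[of \<phi>] by (force simp: is_arg_max_def)
    then obtain a b c where "\<phi> = trace_window a b c" "b + c = - a"
      unfolding max by blast
    with m show ?thesis
      by (simp add: trace_class_def)
  qed
  with flat le set show ?thesis
    unfolding \<sigma>_def[symmetric] by blast
qed

end
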